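(* For the reinforcement-learning signaling process described in the context, $(x_n)_{n\in\mathbb{N}}$ converges almost surely to the set $\Gamma$ of equilibria of the mean-field ODE $\frac{dx}{dt}=F(x)$; that is, almost surely the distance from $x_n$ to $\Gamma=\{x\in\Delta: F(x)=0\}$ tends to $0$ as $n\to\infty$.
   Context: Model. Let $M_1,M_2\ge 1$ be integers, let $\mathcal{S}_1,\mathcal{S}_2$ be disjoint finite sets with $|\mathcal{S}_1|=M_1$ (states, which are also the acts) and $|\mathcal{S}_2|=M_2$ (signals), and $\mathcal{S}=\mathcal{S}_1\cup\mathcal{S}_2$. The random process $V(n,i,j)$, $n\in\mathbb{N}=\{0,1,2,\dots\}$, $i\in\mathcal{S}_1$, $j\in\mathcal{S}_2$, starts from $V(0,i,j)=1$ for all $i,j$. At each step, given the past up to time $n$: a state $i\in\mathcal{S}_1$ is drawn uniformly (probability $1/M_1$ each), independently of the past; Sender then chooses signal $j\in\mathcal{S}_2$ with probability $V(n,i,j)/\sum_{l\in\mathcal{S}_2}V(n,i,l)$; then Receiver, seeing only $j$, chooses an act $k\in\mathcal{S}_1$ with probability $V(n,k,j)/\sum_{l\in\mathcal{S}_1}V(n,l,j)$. If $k=i$, then $V(n+1,i,j)=V(n,i,j)+1$ and all other entries are unchanged; if $k\ne i$, no entry changes. Notation. Extend $V$ symmetrically to $\mathcal{S}\times\mathcal{S}$: $V(n,j,i)=V(n,i,j)$ for $i\in\mathcal{S}_1,j\in\mathcal{S}_2$, and $V(n,i,j)=0$ if $i,j$ are both in $\mathcal{S}_1$ or both in $\mathcal{S}_2$.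 Let $T_n^i=\sum_{j\in\mathcal{S}}V(n,i,j)$, $T_n=\sum_{i\in\mathcal{S}_1}T_n^i$, $x_{ij}^n=V(n,i,j)/T_n$, $x_n=(x_{ij}^n)_{i,j\in\mathcal{S}}$. $\Delta$ is the simplex of symmetric arrays $(x_{ij})_{i,j\in\mathcal{S}}$ with $x_{ij}=x_{ji}\ge0$, $x_{ij}=0$ if $i,j$ are in the same part, and $\sum_{i\in\mathcal{S}_1,j\in\mathcal{S}_2}x_{ij}=1$. For $x\in\Delta$, $x_i=\sum_{j\in\mathcal{S}}x_{ij}$, $H(x)=\sum_{i\in\mathcal{S}_1,\,j\in\mathcal{S}_2:\,x_{ij}>0}\frac{x_{ij}^2}{x_ix_j}$, and $F(x)=(F_{ij}(x))_{i,j\in\mathcal{S}}$ with $F_{ij}(x)=x_{ij}\left(\frac{x_{ij}}{x_ix_j}-H(x)\right)$ if $x_{ij}>0$ and $F_{ij}(x)=0$ if $x_{ij}=0$. *)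

theory Defs
  imports "HOL-Probability.Probability"
begin

text \<open>
  The parts \<open>S\<^sub>1\<close> (states, which are also the acts) and \<open>S\<^sub>2\<close> (signals) are the nonempty finite types
  \<open>'a\<close> and \<open>'b\<close>. Their disjoint union \<open>S\<close> is the sum type \<open>'a + 'b\<close>, and arrays indexed by
  \<open>S \<times> S\<close> are elements of the Euclidean space \<open>real ^ ('a + 'b) ^ ('a + 'b)\<close>.
\<close>

abbreviation S1 :: "('a + 'b) set" where "S1 \<equiv> range Inl"
abbreviation S2 :: "('a + 'b) set" where "S2 \<equiv> range Inr"


section \<open>The process\<close>

text \<open>Only meaningful if some weight is positive. The weights of the process are always at least 1.\<close>

definition proportional :: "('c::finite \<Rightarrow> nat) \<Rightarrow> 'c pmf" where
  "proportional w = embed_pmf (\<lambda>c. real (w c) / real (\<Sum>d\<in>UNIV. w d))"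

lemma pmf_proportional:
  assumes "(\<Sum>d\<in>UNIV. w d) > 0"
  shows "pmf (proportional w) c = real (w c) / real (\<Sum>d\<in>UNIV. w d)"
  unfolding proportional_def
proof (rule pmf_embed_pmf)
  have "(\<Sum>c\<in>UNIV. real (w c) / real (\<Sum>d\<in>UNIV. w d)) = 1"
    using assms by (simp add: sum_divide_distrib [symmetric] del: of_nat_sum sum_eq_0_iff)
       (simp add: of_nat_sum [symmetric] del: of_nat_sum sum_eq_0_iff)
  then show "(\<integral>\<^sup>+ c. ennreal (real (w c) / real (\<Sum>d\<in>UNIV. w d)) \<partial>count_space UNIV) = 1"
    by (subst nn_integral_count_space_finite) (simp_all add: sum_ennreal sum_nonneg)
qed (auto intro!: divide_nonneg_nonneg sum_nonneg)

text \<open>Here \<open>i\<close> is the state, \<open>j\<close> Sender's signal and \<open>k\<close> Receiver's act.\<close>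

definition signaling_step :: "('a::finite \<Rightarrow> 'b::finite \<Rightarrow> nat) \<Rightarrow> ('a \<Rightarrow> 'b \<Rightarrow> nat) pmf" where
  "signaling_step v = do {
     i \<leftarrow> pmf_of_set (UNIV :: 'a set);
     j \<leftarrow> proportional (\<lambda>l. v i l);
     k \<leftarrow> proportional (\<lambda>l. v l j);
     return_pmf (if k = i then v(i := (v i)(j := v i j + 1)) else v)
   }"

text \<open>
  The past up to time \<open>n\<close> is \<open>F n\<close>, for an arbitrary filtration \<open>F\<close> to which \<open>V\<close> is adapted;
  it may carry more information than the process itself, such as the states, signals and acts
  of earlier rounds.
\<close>

locale signaling_process =
  prob_space M + filtration "space M" F
  for M :: "'w measure" and F :: "nat \<Rightarrow> 'w measure" +
  fixes V :: "nat \<Rightarrow> 'w \<Rightarrow> 'a::finite \<Rightarrow> 'b::finite \<Rightarrow> nat"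
  assumes subalg: "\<And>n. subalgebra M (F n)"
    and adapted: "\<And>n. V n \<in> F n \<rightarrow>\<^sub>M count_space UNIV"
    and start: "\<And>\<omega> i j. \<omega> \<in> space M \<Longrightarrow> V 0 \<omega> i j = 1"
    and transition: "\<And>n v. AE \<omega> in M.
      real_cond_exp M (F n) (indicat_real {\<omega>' \<in> space M. V (Suc n) \<omega>' = v}) \<omega>
        = pmf (signaling_step (V n \<omega>)) v"

fun sym_ext :: "('a \<Rightarrow> 'b \<Rightarrow> nat) \<Rightarrow> 'a + 'b \<Rightarrow> 'a + 'b \<Rightarrow> nat" where
  "sym_ext v (Inl i) (Inr j) = v i j"
| "sym_ext v (Inr j) (Inl i) = v i j"
| "sym_ext v _ _ = 0"

text \<open>With \<open>v = V(n)\<close>, the next three are \<open>T\<^sub>n\<^sup>i\<close>, \<open>T\<^sub>n\<close> and \<open>x\<^sub>n\<close>.\<close>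

definition T_at :: "('a::finite \<Rightarrow> 'b::finite \<Rightarrow> nat) \<Rightarrow> 'a + 'b \<Rightarrow> nat" where
  "T_at v i = (\<Sum>j\<in>UNIV. sym_ext v i j)"

definition T_total :: "('a::finite \<Rightarrow> 'b::finite \<Rightarrow> nat) \<Rightarrow> nat" where
  "T_total v = (\<Sum>i\<in>S1. T_at v i)"

definition normalized :: "('a::finite \<Rightarrow> 'b::finite \<Rightarrow> nat) \<Rightarrow> real ^ ('a + 'b) ^ ('a + 'b)" where
  "normalized v = (\<chi> i j. real (sym_ext v i j) / real (T_total v))"


section \<open>The mean-field vector field\<close>

definition Delta :: "(real ^ ('a::finite + 'b::finite) ^ ('a + 'b)) set" where
  "Delta = {x. (\<forall>i j. x $ i $ j = x $ j $ i) \<and> (\<forall>i j. 0 \<le> x $ i $ j) \<and>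
               (\<forall>i j. (i \<in> S1 \<and> j \<in> S1) \<or> (i \<in> S2 \<and> j \<in> S2) \<longrightarrow> x $ i $ j = 0) \<and>
               (\<Sum>i\<in>S1. \<Sum>j\<in>S2. x $ i $ j) = 1}"

definition marginal :: "real ^ ('a::finite + 'b::finite) ^ ('a + 'b) \<Rightarrow> 'a + 'b \<Rightarrow> real" where
  "marginal x i = (\<Sum>j\<in>UNIV. x $ i $ j)"

definition H :: "real ^ ('a::finite + 'b::finite) ^ ('a + 'b) \<Rightarrow> real" where
  "H x = (\<Sum>(i, j) \<in> {(i, j). i \<in> S1 \<and> j \<in> S2 \<and> x $ i $ j > 0}.
            (x $ i $ j)\<^sup>2 / (marginal x i * marginal x j))"

definition mean_field ::
    "real ^ ('a::finite + 'b::finite) ^ ('a + 'b) \<Rightarrow> real ^ ('a + 'b) ^ ('a + 'b)" where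
  "mean_field x = (\<chi> i j. if x $ i $ j > 0
     then x $ i $ j * (x $ i $ j / (marginal x i * marginal x j) - H x) else 0)"

definition equilibria :: "(real ^ ('a::finite + 'b::finite) ^ ('a + 'b)) set" where
  "equilibria = {x \<in> Delta. mean_field x = 0}"

text \<open>
  \<^const>\<open>infdist\<close> to the empty set is 0 by convention, so a statement about the distance to
  \<^const>\<open>equilibria\<close> relies on this set being nonempty. It contains the uniform array.
\<close>

lemma equilibria_nonempty: "(equilibria :: (real ^ ('a::finite + 'b::finite) ^ ('a + 'b)) set) \<noteq> {}"
proof -
  define A where "A = real CARD('a)"
  define B where "B = real CARD('b)"
  have pos: "A > 0" "B > 0" by (auto simp: A_def B_def)
  define x :: "real ^ ('a + 'b) ^ ('a + 'b)"
    where "x = (\<chi> i j. if isl i = isl j then 0 else 1 / (A * B))"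
  have e: "x $ Inl i $ Inr j = 1 / (A * B)" "x $ Inr j $ Inl i = 1 / (A * B)"
    "x $ Inl i $ Inl i' = 0" "x $ Inr j $ Inr j' = 0" for i i' j j'
    by (simp_all add: x_def)
  have split: "(\<Sum>j\<in>UNIV. g j) = (\<Sum>j\<in>UNIV. g (Inl j)) + (\<Sum>j\<in>UNIV. g (Inr j))"
    for g :: "'a + 'b \<Rightarrow> real"
    by (simp add: UNIV_Plus_UNIV [symmetric] sum.Plus del: UNIV_Plus_UNIV)
  have m: "marginal x (Inl i) = 1 / A" "marginal x (Inr j) = 1 / B" for i j
    using pos by (simp_all add: marginal_def split x_def A_def B_def)
  have H: "H x = 1"
  proof -
    have "{(i, j). i \<in> S1 \<and> j \<in> S2 \<and> x $ i $ j > 0} = (S1 :: ('a + 'b) set) \<times> S2"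
      using pos by (auto simp: x_def)
    then have "H x = (\<Sum>i\<in>S1. \<Sum>j\<in>S2. (x $ i $ j)\<^sup>2 / (marginal x i * marginal x j))"
      by (simp add: H_def sum.cartesian_product)
    also have "\<dots> = (\<Sum>i\<in>(UNIV :: 'a set). \<Sum>j\<in>(UNIV :: 'b set). 1 / (A * B))"
      using pos by (simp add: sum.reindex m e power2_eq_square)
    also have "\<dots> = 1"
      using pos by (simp add: A_def B_def)
    finally show ?thesis .
  qed
  have "mean_field x = 0"
  proof -
    have "mean_field x $ i $ j = 0" for i j
      using pos by (cases i; cases j) (simp_all add: mean_field_def H m e)
    then show ?thesis by (simp add: vec_eq_iff)
  qed
  moreover have "x \<in> Delta"
    using pos by (auto simp: Delta_def x_def sum.reindex) (simp_all add: A_def B_def)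
  ultimately show ?thesis by (auto simp: equilibria_def)
qed

end

theory Submission
  imports Defs
begin

text \<open>
  Write \<open>p\<^sub>i\<^sub>j = V\<^sub>i\<^sub>j\<^sup>2 / (T\<^sup>i T\<^sup>j)\<close>, \<open>y\<^sub>i\<^sub>j = x\<^sub>i\<^sub>j / (x\<^sub>i x\<^sub>j)\<close> and \<open>H = \<Sum> p\<^sub>i\<^sub>j = \<Sum> x\<^sub>i\<^sub>j y\<^sub>i\<^sub>j\<close>, so that the mean field is
  \<open>F\<^sub>i\<^sub>j = x\<^sub>i\<^sub>j (y\<^sub>i\<^sub>j - H)\<close>. Along the ODE, \<open>H\<close> increases at rate \<open>L\<close>, the sum over all states and signals
  of the weighted variance of \<open>y\<close> among the edges at that vertex. This vanishes whenever \<open>y\<close> is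
  constant on each connected component, so \<open>H\<close> alone does not detect the equilibria.

  The second ingredient is \<open>Q = \<Sum> x\<^sub>i\<^sub>j / (1 + y\<^sub>i\<^sub>j)\<close>. Its Jensen gap \<open>E = Q - 1 / (1 + H)\<close> is nonnegative and
  bounds \<open>|F|\<^sup>2\<close> up to a constant. The change of \<open>Q\<close> caused by the change of \<open>x\<close> is at most \<open>-E\<close>. The
  change caused by that of \<open>p\<close> is a sum of covariances of \<open>y\<close> with a 1-Lipschitz function of \<open>y\<close>, hence at
  most \<open>L\<close>, also near the faces of the simplex where \<open>y\<close> is unbounded. So \<open>Q - H\<close> decreases at rate
  at least \<open>E\<close>.

  For the process, all second-order terms and the squared increments are bounded by multiples of the
  decrease of \<open>\<Sum> 1 / T\<^sup>i\<close> over all vertices, which telescopes. Hence the martingale parts of \<open>H\<close> and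
  \<open>Q - H\<close> converge almost surely, so \<open>E\<close> converges and \<open>\<Sum>\<^sub>n E / T\<^sub>n < \<infinity>\<close>, which forces \<open>E \<longlonglongrightarrow> 0\<close>.
\<close>

section \<open>Counts and success probabilities\<close>

definition row_sum :: "('a::finite \<Rightarrow> 'b::finite \<Rightarrow> nat) \<Rightarrow> 'a \<Rightarrow> real" where
  "row_sum v i = (\<Sum>j\<in>UNIV. real (v i j))"

definition col_sum :: "('a::finite \<Rightarrow> 'b::finite \<Rightarrow> nat) \<Rightarrow> 'b \<Rightarrow> real" where
  "col_sum v j = (\<Sum>i\<in>UNIV. real (v i j))"

definition tot :: "('a::finite \<Rightarrow> 'b::finite \<Rightarrow> nat) \<Rightarrow> real" where
  "tot v = (\<Sum>i\<in>UNIV. row_sum v i)"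

text \<open>Given state \<open>i\<close>, Sender picks \<open>j\<close> with probability
  \<open>V_ij / T^i\<close> and Receiver then picks \<open>i\<close> with probability
  \<open>V_ij / T^j\<close>. The edge is therefore reinforced with probability
  \<open>succ_prob v i j\<close> divided by the number of states.\<close>

definition succ_prob :: "('a::finite \<Rightarrow> 'b::finite \<Rightarrow> nat) \<Rightarrow> 'a \<Rightarrow> 'b \<Rightarrow> real" where
  "succ_prob v i j = (real (v i j))\<^sup>2 / (row_sum v i * col_sum v j)"

definition share :: "('a::finite \<Rightarrow> 'b::finite \<Rightarrow> nat) \<Rightarrow> 'a \<Rightarrow> 'b \<Rightarrow> real" where
  "share v i j = real (v i j) / tot v"

definition bump :: "('a \<Rightarrow> 'b \<Rightarrow> nat) \<Rightarrow> 'a \<Rightarrow> 'b \<Rightarrow> 'a \<Rightarrow> 'b \<Rightarrow> nat" where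
  "bump v k l = v(k := (v k)(l := v k l + 1))"

text \<open>For positive counts this is \<open>H\<close> at the normalized array, since each summand
  is homogeneous of degree zero. It is also the success probability of one round times the number of
  states.\<close>

definition potential :: "('a::finite \<Rightarrow> 'b::finite \<Rightarrow> nat) \<Rightarrow> real" where
  "potential v = (\<Sum>i\<in>UNIV. \<Sum>j\<in>UNIV. succ_prob v i j)"

text \<open>This is \<open>Q\<close>: since \<open>p = x * y\<close>, the summand
  \<open>x^2 / (x + p)\<close> is \<open>x / (1 + y)\<close>. Written in \<open>x\<close> and
  \<open>p\<close> it is jointly convex and its increments have an exact second-order
  remainder.\<close>

definition convex_sum :: "('a::finite \<Rightarrow> 'b::finite \<Rightarrow> nat) \<Rightarrow> real" where
  "convex_sum v = (\<Sum>i\<in>UNIV. \<Sum>j\<in>UNIV. (share v i j)\<^sup>2 / (share v i j + succ_prob v i j))"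

definition gap :: "('a::finite \<Rightarrow> 'b::finite \<Rightarrow> nat) \<Rightarrow> real" where
  "gap v = convex_sum v - 1 / (1 + potential v)"

text \<open>A success on the edge \<open>k l\<close> decreases this by the order of \<open>1 / T\<^sub>k\<^sup>2 + 1 / T\<^sub>l\<^sup>2\<close>, the size of all
  second-order terms.\<close>

definition clock :: "('a::finite \<Rightarrow> 'b::finite \<Rightarrow> nat) \<Rightarrow> real" where
  "clock v = (\<Sum>i\<in>UNIV. 1 / row_sum v i) + (\<Sum>j\<in>UNIV. 1 / col_sum v j)"

definition all_positive :: "('a \<Rightarrow> 'b \<Rightarrow> nat) \<Rightarrow> bool" where
  "all_positive v \<longleftrightarrow> (\<forall>i j. 1 \<le> v i j)"

section \<open>Effect of one success on the counts and on \<open>clock\<close>\<close>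

lemma real_bump:
  "real (bump v k l i j) = real (v i j) + (if i = k \<and> j = l then 1 else 0)"
  by (auto simp: bump_def)

lemma all_positive_bump: "all_positive v \<Longrightarrow> all_positive (bump v k l)"
  by (auto simp: all_positive_def bump_def)

lemma row_bump: "row_sum (bump v k l) i = row_sum v i + (if i = k then 1 else 0)"
  unfolding row_sum_def real_bump sum.distrib by auto

lemma col_bump: "col_sum (bump v k l) j = col_sum v j + (if j = l then 1 else 0)"
  unfolding col_sum_def real_bump sum.distrib by auto

lemma tot_bump: "tot (bump v k l) = tot v + 1"
  unfolding tot_def row_bump sum.distrib by simp

lemma tot_col: "tot v = (\<Sum>j\<in>UNIV. col_sum v j)"
  unfolding tot_def row_sum_def col_sum_def by (rule sum.swap)

lemma entry_le_row: "real (v i j) \<le> row_sum v i"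
  unfolding row_sum_def by (rule member_le_sum) auto

lemma entry_le_col: "real (v i j) \<le> col_sum v j"
  unfolding col_sum_def by (rule member_le_sum[where f="\<lambda>i. real (v i j)"]) auto

lemma row_le_tot: "row_sum v i \<le> tot v"
  unfolding tot_def by (rule member_le_sum) (auto simp: row_sum_def sum_nonneg)

lemma col_le_tot: "col_sum v j \<le> tot v"
  unfolding tot_col by (rule member_le_sum) (auto simp: col_sum_def sum_nonneg)

lemma all_positive_ge_1:
  assumes "all_positive v"
  shows "1 \<le> real (v i j)" "1 \<le> row_sum v i" "1 \<le> col_sum v j" "1 \<le> tot v"
proof -
  show e: "1 \<le> real (v i j)" for i j using assms by (simp add: all_positive_def)
  show r: "1 \<le> row_sum v i" for i using e entry_le_row order_trans by blast
  show "1 \<le> col_sum v j" using e entry_le_col order_trans by blast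
  show "1 \<le> tot v" using r row_le_tot order_trans by blast
qed

lemma inverse_diff_Suc:
  fixes r :: real assumes "1 \<le> r" shows "1 / r - 1 / (r + 1) = 1 / (r * (r + 1))"
proof -
  have "r \<noteq> 0" "r + 1 \<noteq> 0" using assms by auto
  then show ?thesis by (simp add: divide_simps)
qed

lemma clock_drop:
  assumes "all_positive v"
  shows "clock v - clock (bump v k l)
    = 1 / (row_sum v k * (row_sum v k + 1)) + 1 / (col_sum v l * (col_sum v l + 1))"
proof -
  have "(\<Sum>i\<in>UNIV. 1 / row_sum v i) - (\<Sum>i\<in>UNIV. 1 / row_sum (bump v k l) i)
      = (\<Sum>i\<in>UNIV. if i = k then 1 / (row_sum v k * (row_sum v k + 1)) else 0)"
    unfolding sum_subtractf[symmetric]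
  proof (rule sum.cong)
    fix i
    show "1 / row_sum v i - 1 / row_sum (bump v k l) i = (if i = k then 1 / (row_sum v k * (row_sum v k + 1)) else 0)"
      using all_positive_ge_1(2)[OF assms, of i] by (auto simp: row_bump inverse_diff_Suc)
  qed simp
  moreover have "(\<Sum>j\<in>UNIV. 1 / col_sum v j) - (\<Sum>j\<in>UNIV. 1 / col_sum (bump v k l) j)
      = (\<Sum>j\<in>UNIV. if j = l then 1 / (col_sum v l * (col_sum v l + 1)) else 0)"
    unfolding sum_subtractf[symmetric]
  proof (rule sum.cong)
    fix j
    show "1 / col_sum v j - 1 / col_sum (bump v k l) j = (if j = l then 1 / (col_sum v l * (col_sum v l + 1)) else 0)"
      using all_positive_ge_1(3)[OF assms, of j] by (auto simp: col_bump inverse_diff_Suc)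
  qed simp
  ultimately show ?thesis by (simp add: clock_def)
qed

lemma inverse_sq_le:
  fixes r :: real assumes "1 \<le> r" shows "1 / r\<^sup>2 \<le> 2 / (r * (r + 1))"
proof -
  have "r * 1 \<le> r * r" using assms by (intro mult_left_mono) auto
  then have "r * (r + 1) \<le> 2 * r\<^sup>2" by (simp add: algebra_simps power2_eq_square)
  then have "2 / (2 * r\<^sup>2) \<le> 2 / (r * (r + 1))"
    using assms by (intro divide_left_mono) auto
  then show ?thesis by simp
qed

text \<open>Each inverse square \<open>1 / r^2\<close> is at most twice the corresponding part of
  the decrease, and \<open>2ab \<le> a^2 + b^2\<close> does the rest. The first bound absorbs
  second-order drift errors, the second one squared increments.\<close>

lemma clock_drop_ge:
  assumes "all_positive v"
  shows "1 / (row_sum v k * col_sum v l) \<le> clock v - clock (bump v k l)" (is ?A)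
    and "((1 / row_sum v k + 1 / col_sum v l))\<^sup>2 \<le> 4 * (clock v - clock (bump v k l))" (is ?B)
proof -
  define a b where "a = 1 / row_sum v k" and "b = 1 / col_sum v l"
  have "a\<^sup>2 + b\<^sup>2 \<le> 2 * (clock v - clock (bump v k l))"
    unfolding a_def b_def clock_drop[OF assms]
    using inverse_sq_le[OF all_positive_ge_1(2)[OF assms, of k]]
      inverse_sq_le[OF all_positive_ge_1(3)[OF assms, of l]]
    by (simp add: power_one_over)
  moreover have "2 * (a * b) \<le> a\<^sup>2 + b\<^sup>2" using sum_squares_bound[of a b] by simp
  ultimately have ab: "a * b \<le> clock v - clock (bump v k l)"
    and sq: "a\<^sup>2 + b\<^sup>2 + 2 * (a * b) \<le> 4 * (clock v - clock (bump v k l))" by argo+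
  show ?A using ab by (simp add: a_def b_def)
  show ?B using sq unfolding a_def[symmetric] b_def[symmetric] by (simp add: power2_sum)
qed

section \<open>First-order estimates for a squared count over a product of sums\<close>

text \<open>Multiply the bounds \<open>(1 - 1/t) / t \<le> 1 / (t + 1)\<close> for
  \<open>t = r\<close> and \<open>t = c\<close>, and drop the nonnegative term
  \<open>(1 / (r * c))^2\<close>.\<close>

lemma inverse_bumped_ge:
  fixes r c :: real
  assumes "1 \<le> r" "1 \<le> c"
  shows "(1 - 1/r - 1/c) / (r * c) \<le> 1 / ((r + 1) * (c + 1))"
proof -
  have a: "(1 - 1/t) / t \<le> 1 / (t + 1)" if "1 \<le> t" for t :: real
    using that by (simp add: field_simps)
  have "((1 - 1/r) / r) * ((1 - 1/c) / c) = (1 - 1/r - 1/c) / (r * c) + (1 / (r * c))\<^sup>2"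
    by (simp add: divide_inverse algebra_simps power2_eq_square)
  then have "(1 - 1/r - 1/c) / (r * c) \<le> ((1 - 1/r) / r) * ((1 - 1/c) / c)" by simp
  also have "\<dots> \<le> (1 / (r + 1)) * (1 / (c + 1))"
    using assms by (intro mult_mono a) auto
  finally show ?thesis by simp
qed

text \<open>Apart from \<open>4 / (r * c)\<close>, the left side is the derivative of
  \<open>a^2 / (r * c)\<close> in the direction \<open>(1, 1, 1)\<close>. The error is controlled
  because \<open>a / r + a / c \<le> 2\<close>.\<close>

lemma square_ratio_ge:
  fixes a r c :: real
  assumes "1 \<le> a" "a \<le> r" "a \<le> c"
  shows "2 * a / (r * c) - 4 / (r * c) - a\<^sup>2 / (r * c) / r - a\<^sup>2 / (r * c) / c
    \<le> (a + 1)\<^sup>2 / ((r + 1) * (c + 1)) - a\<^sup>2 / (r * c)"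
proof -
  have rc: "1 \<le> r" "1 \<le> c" using assms by auto
  have "a / r \<le> 1" "a / c \<le> 1" using assms by auto
  then have ar: "a / r + a / c \<le> 2" by linarith
  have "2 * a / (r * c) * (1 / r + 1 / c) = (a / r + a / c) * (2 / (r * c))"
    using rc by (simp add: field_simps)
  also have "\<dots> \<le> 2 * (2 / (r * c))"
    using ar rc by (intro mult_right_mono) auto
  finally have e: "2 * a / (r * c) * (1 / r + 1 / c) \<le> 4 / (r * c)" by simp
  have "(a\<^sup>2 + 2 * a) * ((1 - 1/r - 1/c) / (r * c)) \<le> (a + 1)\<^sup>2 * (1 / ((r + 1) * (c + 1)))"
  proof (rule order_trans)
    show "(a\<^sup>2 + 2 * a) * ((1 - 1/r - 1/c) / (r * c)) \<le> (a\<^sup>2 + 2 * a) * (1 / ((r + 1) * (c + 1)))"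
      using assms by (intro mult_left_mono inverse_bumped_ge rc) auto
    show "(a\<^sup>2 + 2 * a) * (1 / ((r + 1) * (c + 1))) \<le> (a + 1)\<^sup>2 * (1 / ((r + 1) * (c + 1)))"
      using rc by (intro mult_right_mono) (auto simp: power2_sum)
  qed
  moreover have "(a\<^sup>2 + 2 * a) * ((1 - 1/r - 1/c) / (r * c))
    = a\<^sup>2 / (r * c) + 2 * a / (r * c) - a\<^sup>2 / (r * c) / r - a\<^sup>2 / (r * c) / c
       - 2 * a / (r * c) * (1 / r + 1 / c)"
    by (simp add: diff_divide_distrib add_divide_distrib algebra_simps)
  ultimately show ?thesis using e by simp
qed

text \<open>A fraction \<open>a / t \<le> 1\<close> grows when 1 is added to both of its parts. The
  upper bound discards the growth of the denominators and uses \<open>1 \<le> a\<close> in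
  \<open>(a + 1)^2 \<le> a^2 + 3 * a\<close>.\<close>

lemma square_ratio_diff:
  fixes a r c :: real
  assumes "1 \<le> a" "a \<le> r" "a \<le> c"
  shows "a\<^sup>2 / (r * c) \<le> (a + 1)\<^sup>2 / ((r + 1) * (c + 1))" (is ?A)
    and "(a + 1)\<^sup>2 / ((r + 1) * (c + 1)) - a\<^sup>2 / (r * c) \<le> 3 * a / (r * c)" (is ?B)
proof -
  have m: "a / t \<le> (a + 1) / (t + 1)" if "a \<le> t" for t
    using that assms by (simp add: field_simps)
  have "(a / r) * (a / c) \<le> ((a + 1) / (r + 1)) * ((a + 1) / (c + 1))"
    using assms by (intro mult_mono m) auto
  then show ?A by (simp add: power2_eq_square)
  have "(a + 1)\<^sup>2 / ((r + 1) * (c + 1)) \<le> (a\<^sup>2 + 3 * a) / (r * c)"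
    using assms by (intro frac_le mult_mono) (auto simp: power2_sum)
  then show ?B by (simp add: add_divide_distrib)
qed


section \<open>Drift of the communication potential\<close>

text \<open>The three conditional terms are the first-order effects of the count, the row sum and
  the column sum, so one formula covers every position of \<open>i j\<close> relative to
  \<open>k l\<close>. On an edge sharing just one vertex the loss is exactly
  \<open>p / (t + 1) \<le> p / t\<close>.\<close>

lemma succ_prob_bump_ge:
  assumes "all_positive v"
  shows "(if i = k \<and> j = l then 2 * real (v i j) / (row_sum v i * col_sum v j) - 4 / (row_sum v i * col_sum v j) else 0)
      - (if i = k then succ_prob v i j / row_sum v i else 0)
      - (if j = l then succ_prob v i j / col_sum v j else 0)
    \<le> succ_prob (bump v k l) i j - succ_prob v i j"
proof -
  note pos = all_positive_ge_1[OF assms]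
  define a r c where "a = real (v i j)" and "r = row_sum v i" and "c = col_sum v j"
  have arc: "1 \<le> a" "a \<le> r" "a \<le> c" "1 \<le> r" "1 \<le> c"
    using pos entry_le_row[of v i j] entry_le_col[of v i j] by (auto simp: a_def r_def c_def)
  have shrink: "- (q / t) \<le> q * t / (t + 1) - q" if "1 \<le> t" "0 \<le> q" for t q :: real
  proof -
    have "q * t / (t + 1) - q = - (q / (t + 1))" using that by (simp add: field_simps)
    moreover have "q / (t + 1) \<le> q / t" using that by (intro divide_left_mono) auto
    ultimately show ?thesis by simp
  qed
  have q: "0 \<le> a\<^sup>2 / (r * c)" using arc by auto
  consider "i = k" "j = l" | "i = k" "j \<noteq> l" | "i \<noteq> k" "j = l" | "i \<noteq> k" "j \<noteq> l" by blast
  then show ?thesis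
  proof cases
    case 1
    then show ?thesis using square_ratio_ge[OF arc(1-3)]
      by (simp add: succ_prob_def row_bump col_bump real_bump a_def r_def c_def)
  next
    case 2
    then show ?thesis using shrink[OF arc(4) q] arc
      by (simp add: succ_prob_def row_bump col_bump real_bump a_def r_def c_def mult_ac)
  next
    case 3
    then show ?thesis using shrink[OF arc(5) q] arc
      by (simp add: succ_prob_def row_bump col_bump real_bump a_def r_def c_def mult_ac)
  next
    case 4
    then show ?thesis by (simp add: succ_prob_def row_bump col_bump real_bump)
  qed
qed

lemma all_positive_gt_0:
  assumes "all_positive v"
  shows "0 < row_sum v i" "0 < col_sum v j" "0 < tot v"
  using all_positive_ge_1(2)[OF assms, of i] all_positive_ge_1(3)[OF assms, of j] all_positive_ge_1(4)[OF assms]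
  by linarith+

lemma succ_prob_nonneg: "0 \<le> succ_prob v i j"
  by (simp add: succ_prob_def row_sum_def col_sum_def sum_nonneg)

lemma succ_prob_le_1:
  assumes "all_positive v" shows "succ_prob v i j \<le> 1"
proof -
  have "real (v i j) * real (v i j) \<le> row_sum v i * col_sum v j"
    using entry_le_row[of v i j] entry_le_col[of v i j] by (intro mult_mono) auto
  then show ?thesis
    using all_positive_gt_0[OF assms] by (simp add: succ_prob_def power2_eq_square)
qed

lemma succ_prob_bump_self:
  assumes "all_positive v"
  shows "succ_prob v k l \<le> succ_prob (bump v k l) k l"
    and "succ_prob (bump v k l) k l - succ_prob v k l
           \<le> 3 * real (v k l) / (row_sum v k * col_sum v l)"
  using square_ratio_diff[OF all_positive_ge_1(1)[OF assms] entry_le_row[of v k l] entry_le_col[of v k l]]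
  by (simp_all add: succ_prob_def row_bump col_bump real_bump)

lemma succ_prob_bump_other:
  assumes "all_positive v" "i \<noteq> k \<or> j \<noteq> l"
  shows "succ_prob (bump v k l) i j \<le> succ_prob v i j"
proof -
  note pos = all_positive_gt_0[OF assms(1)]
  have "0 < row_sum v i * col_sum v j" using pos by simp
  moreover have "row_sum v i * col_sum v j \<le> row_sum (bump v k l) i * col_sum (bump v k l) j"
    using pos(1)[of i] pos(2)[of j] by (intro mult_mono) (auto simp: row_bump col_bump)
  moreover have "real (bump v k l i j) = real (v i j)"
    using assms(2) by (auto simp: real_bump)
  ultimately show ?thesis
    unfolding succ_prob_def by (auto intro!: divide_left_mono mult_pos_pos simp: pos all_positive_gt_0 all_positive_bump assms(1))
qed

text \<open>The reinforced edge gains at most \<open>3 * V_kl / (T^k * T^l) \<le> 3 / T^k\<close>.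
  Any other edge does not gain, and loses at most the sum of the two reciprocals because
  \<open>p \<le> 1\<close>.\<close>

lemma succ_prob_bump_abs:
  assumes "all_positive v"
  shows "\<bar>succ_prob (bump v k l) i j - succ_prob v i j\<bar> \<le> 3 * (1 / row_sum v k + 1 / col_sum v l)"
proof (cases "i = k \<and> j = l")
  case True
  note pos = all_positive_ge_1[OF assms]
  have "3 * real (v k l) / (row_sum v k * col_sum v l) = 3 * (real (v k l) / col_sum v l) * (1 / row_sum v k)"
    by simp
  also have "\<dots> \<le> 3 * 1 * (1 / row_sum v k)"
    using entry_le_col[of v k l] all_positive_gt_0[OF assms]
    by (intro mult_right_mono mult_left_mono) (auto simp: less_imp_le)
  also have "\<dots> \<le> 3 * (1 / row_sum v k + 1 / col_sum v l)"
    using all_positive_gt_0(2)[OF assms, of l] by simp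
  finally show ?thesis using succ_prob_bump_self[OF assms, of k l] True by auto
next
  case False
  note pos = all_positive_ge_1[OF assms]
  have p: "succ_prob v i j / t \<le> 1 / t" "0 \<le> succ_prob v i j / t" if "1 \<le> t" for t
    using that succ_prob_le_1[OF assms, of i j] succ_prob_nonneg[of v i j]
    by (auto intro!: divide_right_mono)
  have rc: "0 < 1 / row_sum v k" "0 < 1 / col_sum v l"
    using all_positive_gt_0[OF assms] by auto
  have "- (1 / row_sum v k) - 1 / col_sum v l \<le> succ_prob (bump v k l) i j - succ_prob v i j"
    using succ_prob_bump_ge[OF assms, of i k j l] p[OF pos(2), of k] p[OF pos(3), of l] rc False
    by (auto split: if_splits)
  moreover have "succ_prob (bump v k l) i j \<le> succ_prob v i j"
    using succ_prob_bump_other[OF assms] False by blast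
  ultimately show ?thesis using rc by (simp add: abs_le_iff)
qed

section \<open>Vertex means, dispersion and the drift operator\<close>

text \<open>This is \<open>y_ij / T_n\<close>; leaving out the total keeps it a function of local
  counts.\<close>

definition ratio :: "('a::finite \<Rightarrow> 'b::finite \<Rightarrow> nat) \<Rightarrow> 'a \<Rightarrow> 'b \<Rightarrow> real" where
  "ratio v i j = real (v i j) / (row_sum v i * col_sum v j)"

text \<open>Since \<open>succ_prob\<close> is the count times \<open>ratio\<close>, this is the mean
  of \<open>ratio\<close> over the edges at \<open>i\<close>, weighted by the counts;
  \<open>col_rate\<close> is its analogue for a signal.\<close>

definition row_rate :: "('a::finite \<Rightarrow> 'b::finite \<Rightarrow> nat) \<Rightarrow> 'a \<Rightarrow> real" where
  "row_rate v i = (\<Sum>j\<in>UNIV. succ_prob v i j) / row_sum v i"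

definition col_rate :: "('a::finite \<Rightarrow> 'b::finite \<Rightarrow> nat) \<Rightarrow> 'b \<Rightarrow> real" where
  "col_rate v j = (\<Sum>i\<in>UNIV. succ_prob v i j) / col_sum v j"

text \<open>With \<open>x = V / T_n\<close> and \<open>y = T_n * ratio\<close>, this is
  \<open>L / T_n\<close>, the rate \<open>L\<close> on the time scale of the process.\<close>

definition dispersion :: "('a::finite \<Rightarrow> 'b::finite \<Rightarrow> nat) \<Rightarrow> real" where
  "dispersion v = (\<Sum>i\<in>UNIV. \<Sum>j\<in>UNIV. real (v i j) * (ratio v i j - row_rate v i)\<^sup>2)
     + (\<Sum>j\<in>UNIV. \<Sum>i\<in>UNIV. real (v i j) * (ratio v i j - col_rate v j)\<^sup>2)"

text \<open>The expected increment of \<open>g\<close>, times the number of states.\<close>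

definition drift :: "(('a::finite \<Rightarrow> 'b::finite \<Rightarrow> nat) \<Rightarrow> real) \<Rightarrow> ('a \<Rightarrow> 'b \<Rightarrow> nat) \<Rightarrow> real" where
  "drift g v = (\<Sum>k\<in>UNIV. \<Sum>l\<in>UNIV. succ_prob v k l * (g (bump v k l) - g v))"

lemma drift_linear:
  "drift (\<lambda>v. f v + g v) v = drift f v + drift g v"
  "drift (\<lambda>v. f v - g v) v = drift f v - drift g v"
  "drift (\<lambda>v. c * f v) v = c * drift f v"
  by (simp_all add: drift_def sum.distrib[symmetric] sum_subtractf[symmetric] sum_distrib_left algebra_simps)

lemma succ_prob_ratio: "succ_prob v i j = real (v i j) * ratio v i j"
  by (simp add: succ_prob_def ratio_def power2_eq_square)

lemma sum_delta_pair:
  fixes f :: "'a::finite \<Rightarrow> 'b::finite \<Rightarrow> real"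
  shows "(\<Sum>k\<in>UNIV. \<Sum>l\<in>UNIV. f k l * (if i = k \<and> j = l then c else 0)) = f i j * c"
    and "(\<Sum>k\<in>UNIV. \<Sum>l\<in>UNIV. f k l * (if i = k then c else 0)) = (\<Sum>l\<in>UNIV. f i l) * c"
    and "(\<Sum>k\<in>UNIV. \<Sum>l\<in>UNIV. f k l * (if j = l then c else 0)) = (\<Sum>k\<in>UNIV. f k j) * c"
proof -
  have "(\<Sum>l\<in>UNIV. f k l * (if i = k \<and> j = l then c else 0)) = (if i = k then f k j * c else 0)" for k
    by (cases "i = k") (simp_all add: if_distrib cong: if_cong)
  then show "(\<Sum>k\<in>UNIV. \<Sum>l\<in>UNIV. f k l * (if i = k \<and> j = l then c else 0)) = f i j * c"
    by simp
  have "(\<Sum>l\<in>UNIV. f k l * (if i = k then c else 0)) = (if i = k then (\<Sum>l\<in>UNIV. f k l) * c else 0)" for k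
    by (simp add: sum_distrib_right)
  then show "(\<Sum>k\<in>UNIV. \<Sum>l\<in>UNIV. f k l * (if i = k then c else 0)) = (\<Sum>l\<in>UNIV. f i l) * c"
    by simp
  show "(\<Sum>k\<in>UNIV. \<Sum>l\<in>UNIV. f k l * (if j = l then c else 0)) = (\<Sum>k\<in>UNIV. f k j) * c"
    by (simp add: if_distrib sum_distrib_right cong: if_cong)
qed

lemma sum4_swap:
  fixes f :: "'a::finite \<Rightarrow> 'b::finite \<Rightarrow> 'a \<Rightarrow> 'b \<Rightarrow> real"
  shows "(\<Sum>k\<in>UNIV. \<Sum>l\<in>UNIV. \<Sum>i\<in>UNIV. \<Sum>j\<in>UNIV. f k l i j)
    = (\<Sum>i\<in>UNIV. \<Sum>j\<in>UNIV. \<Sum>k\<in>UNIV. \<Sum>l\<in>UNIV. f k l i j)"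
proof -
  have "(\<Sum>x\<in>UNIV \<times> UNIV. \<Sum>y\<in>UNIV \<times> UNIV. f (fst x) (snd x) (fst y) (snd y))
      = (\<Sum>y\<in>UNIV \<times> UNIV. \<Sum>x\<in>UNIV \<times> UNIV. f (fst x) (snd x) (fst y) (snd y))"
    by (rule sum.swap)
  then show ?thesis
    by (simp only: sum.cartesian_product[symmetric, where g = "\<lambda>a b. h (a, b)" for h, simplified case_prod_eta] fst_conv snd_conv)
qed

text \<open>Average the first-order lower bounds over the successes and exchange the sums. Edge
  \<open>i j\<close> gains only from its own success, while the successes at its two vertices cost
  it \<open>row_rate\<close> and \<open>col_rate\<close>. Weights equal to 1 give the drift of
  \<open>potential\<close>; smaller ones give the part of the drift of \<open>Q\<close> due to
  \<open>p\<close>.\<close>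

lemma weighted_drift_ge:
  assumes "all_positive v" and \<omega>: "\<And>i j. 0 \<le> \<omega> i j" "\<And>i j. \<omega> i j \<le> 1"
  shows "(\<Sum>i\<in>UNIV. \<Sum>j\<in>UNIV. \<omega> i j * succ_prob v i j * (2 * ratio v i j - row_rate v i - col_rate v j))
      + 4 * drift clock v
    \<le> (\<Sum>k\<in>UNIV. \<Sum>l\<in>UNIV. succ_prob v k l *
         (\<Sum>i\<in>UNIV. \<Sum>j\<in>UNIV. \<omega> i j * (succ_prob (bump v k l) i j - succ_prob v i j)))"
proof -
  let ?p = "succ_prob v"
  define A where "A i j = 2 * ratio v i j - 4 / (row_sum v i * col_sum v j)" for i j
  define B where "B i j = ?p i j / row_sum v i" for i j
  define C where "C i j = ?p i j / col_sum v j" for i j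
  have "(\<Sum>i\<in>UNIV. \<Sum>j\<in>UNIV. \<omega> i j * (?p i j * A i j - (\<Sum>l\<in>UNIV. ?p i l) * B i j - (\<Sum>k\<in>UNIV. ?p k j) * C i j))
      = (\<Sum>i\<in>UNIV. \<Sum>j\<in>UNIV. \<omega> i j * (\<Sum>k\<in>UNIV. \<Sum>l\<in>UNIV. ?p k l *
          ((if i = k \<and> j = l then A i j else 0) - (if i = k then B i j else 0) - (if j = l then C i j else 0))))"
    by (simp only: right_diff_distrib[of "?p _ _"] sum_subtractf sum_delta_pair)
  also have "\<dots> = (\<Sum>k\<in>UNIV. \<Sum>l\<in>UNIV. \<Sum>i\<in>UNIV. \<Sum>j\<in>UNIV. \<omega> i j * (?p k l *
          ((if i = k \<and> j = l then A i j else 0) - (if i = k then B i j else 0) - (if j = l then C i j else 0))))"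
    unfolding sum_distrib_left by (rule sum4_swap[symmetric])
  also have "\<dots> \<le> (\<Sum>k\<in>UNIV. \<Sum>l\<in>UNIV. \<Sum>i\<in>UNIV. \<Sum>j\<in>UNIV. \<omega> i j * (?p k l *
          (succ_prob (bump v k l) i j - succ_prob v i j)))"
    by (intro sum_mono mult_left_mono \<omega>(1) succ_prob_nonneg)
      (use succ_prob_bump_ge[OF assms(1)] in \<open>simp only: A_def B_def C_def ratio_def times_divide_eq_right\<close>)
  also have "\<dots> = (\<Sum>k\<in>UNIV. \<Sum>l\<in>UNIV. ?p k l *
         (\<Sum>i\<in>UNIV. \<Sum>j\<in>UNIV. \<omega> i j * (succ_prob (bump v k l) i j - succ_prob v i j)))"
    by (simp add: sum_distrib_left mult_ac)
  finally have main: "(\<Sum>i\<in>UNIV. \<Sum>j\<in>UNIV. \<omega> i j * (?p i j * A i j - (\<Sum>l\<in>UNIV. ?p i l) * B i j - (\<Sum>k\<in>UNIV. ?p k j) * C i j))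
    \<le> \<dots>" .
  have "\<omega> i j * ?p i j * (2 * ratio v i j - row_rate v i - col_rate v j)
      - 4 * (?p i j * (clock v - clock (bump v i j)))
      \<le> \<omega> i j * (?p i j * A i j - (\<Sum>l\<in>UNIV. ?p i l) * B i j - (\<Sum>k\<in>UNIV. ?p k j) * C i j)" for i j
  proof -
    \<comment> \<open>Because the weight is at most 1, the second-order error is charged to
      \<open>clock\<close> with a constant independent of the weights.\<close>
    have "\<omega> i j * ?p i j * (1 / (row_sum v i * col_sum v j)) \<le> 1 * ?p i j * (clock v - clock (bump v i j))"
      using \<omega> succ_prob_nonneg clock_drop_ge(1)[OF assms(1)] all_positive_ge_1[OF assms(1)]
      by (intro mult_mono) (auto intro!: mult_nonneg_nonneg simp: order_trans[OF zero_le_one])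
    moreover have "\<omega> i j * (?p i j * A i j - (\<Sum>l\<in>UNIV. ?p i l) * B i j - (\<Sum>k\<in>UNIV. ?p k j) * C i j)
      = \<omega> i j * ?p i j * (2 * ratio v i j - row_rate v i - col_rate v j)
        - 4 * (\<omega> i j * ?p i j * (1 / (row_sum v i * col_sum v j)))"
      by (simp add: A_def B_def C_def row_rate_def col_rate_def algebra_simps)
    ultimately show ?thesis by simp
  qed
  then have "(\<Sum>i\<in>UNIV. \<Sum>j\<in>UNIV. \<omega> i j * ?p i j * (2 * ratio v i j - row_rate v i - col_rate v j)
      - 4 * (?p i j * (clock v - clock (bump v i j)))) \<le> (\<Sum>i\<in>UNIV. \<Sum>j\<in>UNIV. \<omega> i j * (?p i j * A i j - (\<Sum>l\<in>UNIV. ?p i l) * B i j - (\<Sum>k\<in>UNIV. ?p k j) * C i j))"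
    by (intro sum_mono)
  moreover have "drift clock v = - (\<Sum>i\<in>UNIV. \<Sum>j\<in>UNIV. ?p i j * (clock v - clock (bump v i j)))"
    by (simp add: drift_def sum_negf[symmetric] algebra_simps)
  ultimately show ?thesis using main
    by (simp add: sum_subtractf sum_distrib_left[symmetric])
qed

section \<open>Covariance bounds for the drift\<close>

text \<open>Centering makes it free to replace \<open>\<phi> (y j)\<close> by
  \<open>\<phi> (y j) - \<phi> m\<close>, which is at most \<open>\<bar>y j - m\<bar>\<close> in
  absolute value.\<close>

lemma covariance_lipschitz:
  fixes y :: "'c \<Rightarrow> real"
  assumes "\<And>j. 0 \<le> a j" "(\<Sum>j\<in>S. a j * (y j - m)) = 0"
    and "\<And>j. \<bar>\<phi> (y j) - \<phi> m\<bar> \<le> \<bar>y j - m\<bar>"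
  shows "\<bar>\<Sum>j\<in>S. a j * \<phi> (y j) * (y j - m)\<bar> \<le> (\<Sum>j\<in>S. a j * (y j - m)\<^sup>2)"
proof -
  have "(\<Sum>j\<in>S. a j * \<phi> (y j) * (y j - m))
      = (\<Sum>j\<in>S. a j * ((\<phi> (y j) - \<phi> m) * (y j - m))) + \<phi> m * (\<Sum>j\<in>S. a j * (y j - m))"
    by (simp add: sum_distrib_left sum.distrib[symmetric] algebra_simps)
  also have "\<bar>\<dots>\<bar> \<le> (\<Sum>j\<in>S. \<bar>a j * ((\<phi> (y j) - \<phi> m) * (y j - m))\<bar>)"
    using assms(2) by simp
  also have "\<dots> \<le> (\<Sum>j\<in>S. a j * (y j - m)\<^sup>2)"
  proof (rule sum_mono)
    fix j
    have "\<bar>\<phi> (y j) - \<phi> m\<bar> * \<bar>y j - m\<bar> \<le> \<bar>y j - m\<bar> * \<bar>y j - m\<bar>"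
      by (intro mult_right_mono assms(3)) auto
    then show "\<bar>a j * ((\<phi> (y j) - \<phi> m) * (y j - m))\<bar> \<le> a j * (y j - m)\<^sup>2"
      using assms(1)[of j] by (simp add: abs_mult power2_eq_square mult_left_mono)
  qed
  finally show ?thesis .
qed

lemma sum_centered:
  assumes "all_positive v"
  shows "(\<Sum>j\<in>UNIV. real (v i j) * (ratio v i j - row_rate v i)) = 0"
    and "(\<Sum>i\<in>UNIV. real (v i j) * (ratio v i j - col_rate v j)) = 0"
proof -
  note pos = all_positive_gt_0[OF assms]
  have "(\<Sum>j\<in>UNIV. real (v i j) * (ratio v i j - row_rate v i))
      = (\<Sum>j\<in>UNIV. succ_prob v i j) - row_sum v i * row_rate v i"
    by (simp only: right_diff_distrib sum_subtractf succ_prob_ratio row_sum_def sum_distrib_right)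
  then show "(\<Sum>j\<in>UNIV. real (v i j) * (ratio v i j - row_rate v i)) = 0"
    using pos(1)[of i] by (simp add: row_rate_def)
  have "(\<Sum>i\<in>UNIV. real (v i j) * (ratio v i j - col_rate v j))
      = (\<Sum>i\<in>UNIV. succ_prob v i j) - col_sum v j * col_rate v j"
    by (simp only: right_diff_distrib sum_subtractf succ_prob_ratio col_sum_def sum_distrib_right)
  then show "(\<Sum>i\<in>UNIV. real (v i j) * (ratio v i j - col_rate v j)) = 0"
    using pos(2)[of j] by (simp add: col_rate_def)
qed

text \<open>Write \<open>2 * ratio\<close> as two copies and pair one with each vertex mean. By
  \<open>sum_centered\<close> each inner sum is then a covariance at a single vertex.\<close>

lemma drift_split:
  "(\<Sum>i\<in>UNIV. \<Sum>j\<in>UNIV. \<omega> i j * succ_prob v i j * (2 * ratio v i j - row_rate v i - col_rate v j))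
   = (\<Sum>i\<in>UNIV. \<Sum>j\<in>UNIV. real (v i j) * (\<omega> i j * ratio v i j) * (ratio v i j - row_rate v i))
   + (\<Sum>j\<in>UNIV. \<Sum>i\<in>UNIV. real (v i j) * (\<omega> i j * ratio v i j) * (ratio v i j - col_rate v j))"
  unfolding sum.swap[of _ "UNIV :: 'b::finite set" "UNIV :: 'a::finite set"] sum.distrib[symmetric] succ_prob_ratio
  by (intro sum.cong) (auto simp: algebra_simps)

lemma dispersion_nonneg: "0 \<le> dispersion v"
  by (auto simp: dispersion_def intro!: sum_nonneg add_nonneg_nonneg)

text \<open>With all weights 1, the covariances at the vertices are the variances that make up
  \<open>dispersion\<close>.\<close>

lemma drift_potential_ge:
  assumes "all_positive v"
  shows "dispersion v + 4 * drift clock v \<le> drift potential v"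
proof -
  have var: "(\<Sum>j\<in>S. a j * y j * (y j - m)) = (\<Sum>j\<in>S. a j * (y j - m)\<^sup>2)"
    if "(\<Sum>j\<in>S. a j * (y j - m)) = 0" for S and a y :: "'c \<Rightarrow> real" and m
  proof -
    have "(\<Sum>j\<in>S. a j * y j * (y j - m)) = (\<Sum>j\<in>S. a j * (y j - m)\<^sup>2) + m * (\<Sum>j\<in>S. a j * (y j - m))"
      by (simp add: sum_distrib_left sum.distrib[symmetric] algebra_simps power2_eq_square)
    then show ?thesis using that by simp
  qed
  have "dispersion v = (\<Sum>i\<in>UNIV. \<Sum>j\<in>UNIV. 1 * succ_prob v i j * (2 * ratio v i j - row_rate v i - col_rate v j))"
    unfolding drift_split[where \<omega> = "\<lambda>_ _. 1"] dispersion_def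
    by (simp add: var[OF sum_centered(1)[OF assms]] var[OF sum_centered(2)[OF assms]])
  also have "\<dots> + 4 * drift clock v \<le> drift potential v"
    using weighted_drift_ge[OF assms, of "\<lambda>_ _. 1"]
    by (simp add: drift_def potential_def sum_subtractf)
  finally show ?thesis .
qed

text \<open>The difference of the cross-multiplied numerators factors as
  \<open>(s - t) * (1 - T^2 * s * t)\<close>, and the second factor is dominated by the denominator.
  The Lipschitz constant 1 does not depend on \<open>T\<close>.\<close>

lemma damped_lipschitz:
  fixes s t T :: real
  assumes "0 \<le> s" "0 \<le> t" "0 \<le> T"
  shows "\<bar>1 / (1 + T * s)\<^sup>2 * s - 1 / (1 + T * t)\<^sup>2 * t\<bar> \<le> \<bar>s - t\<bar>"
proof -
  define a b where "a = 1 + T * s" and "b = 1 + T * t"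
  have ab: "1 \<le> a" "1 \<le> b" using assms by (auto simp: a_def b_def)
  have "1 / a\<^sup>2 * s - 1 / b\<^sup>2 * t = (s * b\<^sup>2 - t * a\<^sup>2) / (a\<^sup>2 * b\<^sup>2)"
    using ab by (simp add: field_simps)
  also have "s * b\<^sup>2 - t * a\<^sup>2 = (s - t) * (1 - (T * s) * (T * t))"
    by (simp add: a_def b_def algebra_simps power2_eq_square)
  finally have eq: "1 / a\<^sup>2 * s - 1 / b\<^sup>2 * t = (s - t) * ((1 - (T * s) * (T * t)) / (a\<^sup>2 * b\<^sup>2))"
    by simp
  have "\<bar>1 - (T * s) * (T * t)\<bar> \<le> 1 + (T * s) * (T * t)"
    using assms by (auto simp: abs_le_iff)
  also have "\<dots> \<le> a * b" using assms by (simp add: a_def b_def algebra_simps)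
  also have "\<dots> \<le> a\<^sup>2 * b\<^sup>2"
    using ab by (intro mult_mono) (auto simp: power2_eq_square)
  finally have "\<bar>(1 - (T * s) * (T * t)) / (a\<^sup>2 * b\<^sup>2)\<bar> \<le> 1"
    using ab by (simp add: abs_mult)
  then have "\<bar>s - t\<bar> * \<bar>(1 - (T * s) * (T * t)) / (a\<^sup>2 * b\<^sup>2)\<bar> \<le> \<bar>s - t\<bar> * 1"
    by (intro mult_left_mono) auto
  then show ?thesis unfolding a_def[symmetric] b_def[symmetric] eq abs_mult by simp
qed

lemma ratio_nonneg: "0 \<le> ratio v i j"
  by (simp add: ratio_def row_sum_def col_sum_def sum_nonneg)

lemma rate_nonneg: "0 \<le> row_rate v i" "0 \<le> col_rate v j"
  by (simp_all add: row_rate_def col_rate_def row_sum_def col_sum_def sum_nonneg succ_prob_nonneg)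

text \<open>The weight \<open>1 / (1 + y)^2\<close> is minus the partial derivative of
  \<open>x^2 / (x + p)\<close> in \<open>p\<close>. Hence the change of \<open>p\<close> raises
  \<open>Q\<close> by at most \<open>dispersion\<close>, up to clock terms, which the rise of
  \<open>potential\<close> can compensate.\<close>

lemma damped_drift_ge:
  assumes "all_positive v"
  shows "- dispersion v + 4 * drift clock v
    \<le> (\<Sum>k\<in>UNIV. \<Sum>l\<in>UNIV. succ_prob v k l *
         (\<Sum>i\<in>UNIV. \<Sum>j\<in>UNIV. 1 / (1 + tot v * ratio v i j)\<^sup>2 * (succ_prob (bump v k l) i j - succ_prob v i j)))"
proof -
  define \<omega> where "\<omega> i j = 1 / (1 + tot v * ratio v i j)\<^sup>2" for i j
  have T: "0 \<le> tot v" using all_positive_ge_1(4)[OF assms] by simp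
  have d: "1 \<le> 1 + tot v * ratio v i j" for i j
    using mult_nonneg_nonneg[OF T ratio_nonneg] by simp
  then have om: "0 \<le> \<omega> i j" "\<omega> i j \<le> 1" for i j
    by (auto simp: \<omega>_def one_le_power divide_le_eq)
  \<comment> \<open>The weight times \<open>ratio\<close> is a function of \<open>ratio\<close>
    alone, and \<open>damped_lipschitz\<close> applies to it.\<close>
  define \<phi> where "\<phi> s = 1 / (1 + tot v * s)\<^sup>2 * s" for s
  have "\<bar>\<Sum>j\<in>UNIV. real (v i j) * \<phi> (ratio v i j) * (ratio v i j - row_rate v i)\<bar>
      \<le> (\<Sum>j\<in>UNIV. real (v i j) * (ratio v i j - row_rate v i)\<^sup>2)" for i
    unfolding \<phi>_def
    by (intro covariance_lipschitz sum_centered[OF assms] damped_lipschitz T ratio_nonneg rate_nonneg) auto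
  then have 1: "- (\<Sum>j\<in>UNIV. real (v i j) * (ratio v i j - row_rate v i)\<^sup>2)
      \<le> (\<Sum>j\<in>UNIV. real (v i j) * \<phi> (ratio v i j) * (ratio v i j - row_rate v i))" for i
    by (simp add: abs_le_iff minus_le_iff)
  have "\<bar>\<Sum>i\<in>UNIV. real (v i j) * \<phi> (ratio v i j) * (ratio v i j - col_rate v j)\<bar>
      \<le> (\<Sum>i\<in>UNIV. real (v i j) * (ratio v i j - col_rate v j)\<^sup>2)" for j
    unfolding \<phi>_def
    by (intro covariance_lipschitz sum_centered[OF assms] damped_lipschitz T ratio_nonneg rate_nonneg) auto
  then have 2: "- (\<Sum>i\<in>UNIV. real (v i j) * (ratio v i j - col_rate v j)\<^sup>2)
      \<le> (\<Sum>i\<in>UNIV. real (v i j) * \<phi> (ratio v i j) * (ratio v i j - col_rate v j))" for j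
    by (simp add: abs_le_iff minus_le_iff)
  have "- dispersion v \<le> (\<Sum>i\<in>UNIV. \<Sum>j\<in>UNIV. \<omega> i j * succ_prob v i j * (2 * ratio v i j - row_rate v i - col_rate v j))"
    unfolding drift_split dispersion_def minus_add_distrib sum_negf[symmetric]
    using sum_mono[where K = UNIV, OF 1] sum_mono[where K = UNIV, OF 2]
    unfolding \<phi>_def \<omega>_def sum_negf by (rule add_mono)
  then show ?thesis
    using weighted_drift_ge[where \<omega> = \<omega>, OF assms om] unfolding \<omega>_def by linarith
qed


section \<open>The Lyapunov function\<close>

text \<open>With \<open>w = x / s\<close>, the gradient of \<open>x^2 / s\<close> is
  \<open>(2 * w, - w^2)\<close>. The remainder is a square over \<open>s'\<close>, so it is
  nonnegative for \<open>s' > 0\<close>; this is the convexity used later.\<close>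

lemma quad_over_linear:
  fixes x x' s s' :: real
  assumes "s \<noteq> 0" "s' \<noteq> 0"
  shows "x'\<^sup>2 / s' - x\<^sup>2 / s
    = 2 * (x / s) * (x' - x) - (x / s)\<^sup>2 * (s' - s) + ((x' - x) - (x / s) * (s' - s))\<^sup>2 / s'"
proof -
  have "x = (x / s) * s" using assms by simp
  then obtain w where w: "w = x / s" "x = w * s" by blast
  have "((x' - x) - w * (s' - s))\<^sup>2 = x'\<^sup>2 - s' * (2 * w * x' - w\<^sup>2 * s')"
    by (simp add: w(2) power2_eq_square algebra_simps)
  then have "((x' - x) - w * (s' - s))\<^sup>2 / s' = x'\<^sup>2 / s' - (2 * w * x' - w\<^sup>2 * s')"
    using assms by (simp add: diff_divide_distrib)
  moreover have "x\<^sup>2 / s = w * x" by (simp add: w(1) power2_eq_square)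
  moreover have "2 * w * (x' - x) - w\<^sup>2 * (s' - s) + (x'\<^sup>2 / s' - (2 * w * x' - w\<^sup>2 * s')) = x'\<^sup>2 / s' - w * x"
    by (simp add: w(2) power2_eq_square algebra_simps)
  ultimately show ?thesis by (simp only: w(1)[symmetric])
qed

lemma share_pos: "all_positive v \<Longrightarrow> 0 < share v i j"
  using all_positive_gt_0(3)[of v] all_positive_ge_1(1)[of v i j] by (simp add: share_def)

lemma tot_ratio_nonneg: "0 \<le> tot v * ratio v i j"
  by (intro mult_nonneg_nonneg ratio_nonneg) (simp add: tot_def row_sum_def sum_nonneg)

lemma entry_le_tot: "real (v i j) \<le> tot v"
  using entry_le_row row_le_tot by (rule order_trans)

lemma share_le_1: "all_positive v \<Longrightarrow> share v i j \<le> 1"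
  using all_positive_gt_0(3)[of v] entry_le_tot[of v i j] by (simp add: share_def)

lemma share_bump:
  assumes "all_positive v"
  shows "share (bump v k l) i j - share v i j = ((if i = k \<and> j = l then 1 else 0) - share v i j) / (tot v + 1)"
  using all_positive_gt_0(3)[OF assms] by (simp add: share_def real_bump tot_bump field_simps)

lemma inverse_tot_sq_le:
  assumes "all_positive v" shows "1 / (tot v)\<^sup>2 \<le> clock v - clock (bump v k l)"
proof -
  note pos = all_positive_gt_0[OF assms]
  have "row_sum v k * col_sum v l \<le> tot v * tot v"
    using pos(2)[of l] pos(3) by (intro mult_mono row_le_tot col_le_tot) auto
  then have "1 / (tot v)\<^sup>2 \<le> 1 / (row_sum v k * col_sum v l)"
    using pos(1)[of k] pos(2)[of l] pos(3) by (intro divide_left_mono) (auto simp: power2_eq_square)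
  then show ?thesis using clock_drop_ge(1)[OF assms, of k l] by linarith
qed

lemma succ_prob_pos: "all_positive v \<Longrightarrow> 0 < succ_prob v i j"
  using all_positive_gt_0[of v] all_positive_ge_1(1)[of v i j] by (simp add: succ_prob_def)

lemma weight_eq:
  assumes "all_positive v"
  shows "share v i j / (share v i j + succ_prob v i j) = 1 / (1 + tot v * ratio v i j)"
    and "succ_prob v i j = share v i j * (tot v * ratio v i j)"
proof -
  show p: "succ_prob v i j = share v i j * (tot v * ratio v i j)"
    using all_positive_gt_0(3)[OF assms] by (simp add: succ_prob_ratio share_def)
  have "share v i j + succ_prob v i j = share v i j * (1 + tot v * ratio v i j)"
    by (simp add: p algebra_simps)
  then show "share v i j / (share v i j + succ_prob v i j) = 1 / (1 + tot v * ratio v i j)"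
    using share_pos[OF assms, of i j] by simp
qed

text \<open>All sums are at least 1, so adding 1 at most doubles each of them. This lets
  denominators after a step be replaced by those before it.\<close>

lemma share_bump_ge:
  assumes "all_positive v"
  shows "share v i j / 2 \<le> share (bump v k l) i j" "succ_prob v i j / 4 \<le> succ_prob (bump v k l) i j"
proof -
  note pos = all_positive_gt_0[OF assms] and ge = all_positive_ge_1[OF assms]
  have "real (v i j) / (tot v * 2) \<le> real (bump v k l i j) / (tot v + 1)"
    using pos(3) ge(4) by (intro frac_le) (auto simp: real_bump)
  then show "share v i j / 2 \<le> share (bump v k l) i j" by (simp add: share_def tot_bump)
  have "(real (v i j))\<^sup>2 / ((2 * row_sum v i) * (2 * col_sum v j)) \<le> (real (bump v k l i j))\<^sup>2 / (row_sum (bump v k l) i * col_sum (bump v k l) j)"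
  proof (rule frac_le)
    show "0 < row_sum (bump v k l) i * col_sum (bump v k l) j"
      using all_positive_gt_0[OF all_positive_bump[OF assms]] by simp
    show "row_sum (bump v k l) i * col_sum (bump v k l) j \<le> (2 * row_sum v i) * (2 * col_sum v j)"
      using ge(2)[of i] ge(3)[of j] by (intro mult_mono) (auto simp: row_bump col_bump)
  qed (auto simp: real_bump)
  then show "succ_prob v i j / 4 \<le> succ_prob (bump v k l) i j" by (simp add: succ_prob_def)
qed

text \<open>The function \<open>x\<^sup>2 / (x + p)\<close> of the two arguments is quadratic over linear, so its second-order
  Taylor remainder has the closed form in \<open>quad_over_linear\<close>.\<close>

lemma quad_remainder_le:
  fixes k l i j
  assumes "all_positive v"
  defines "x \<equiv> share v i j" and "p \<equiv> succ_prob v i j"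
    and "x' \<equiv> share (bump v k l) i j" and "p' \<equiv> succ_prob (bump v k l) i j"
  shows "((x' - x) - (x / (x + p)) * ((x' + p') - (x + p)))\<^sup>2 / (x' + p')
    \<le> 36 * (clock v - clock (bump v k l))" (is "_ \<le> 36 * ?\<delta>")
proof -
  note pos = all_positive_gt_0[OF assms(1)] and ge = all_positive_ge_1[OF assms(1)]
  have xp: "0 < x" "0 < p" "0 < x'" "0 < p'" "x \<le> 1" "p \<le> 1"
    using share_pos[OF assms(1)] succ_prob_pos[OF assms(1)] share_le_1[OF assms(1)] succ_prob_le_1[OF assms(1)]
      share_pos[OF all_positive_bump[OF assms(1)]] succ_prob_pos[OF all_positive_bump[OF assms(1)]]
    by (simp_all add: x_def p_def x'_def p'_def)
  define w where "w = x / (x + p)"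
  have w: "0 \<le> w" "w \<le> 1" "1 - w = p / (x + p)" using xp by (auto simp: w_def field_simps)
  define s' where "s' = x' + p'"
  have s': "0 < s'" "x' \<le> s'" "p' \<le> s'" using xp by (auto simp: s'_def)
  \<comment> \<open>Separating the two increments lets the one of \<open>x\<close> be compared with
    \<open>x'\<close> and the one of \<open>p\<close> with \<open>p'\<close>, as both are at most
    the denominator.\<close>
  have "((x' - x) - w * ((x' + p') - (x + p)))\<^sup>2 = ((1 - w) * (x' - x) - w * (p' - p))\<^sup>2"
    by (simp add: algebra_simps)
  also have "\<dots> \<le> 2 * ((1 - w) * (x' - x))\<^sup>2 + 2 * (w * (p' - p))\<^sup>2"
    using sum_squares_bound[of "(1 - w) * (x' - x)" "- w * (p' - p)"] by (simp add: power2_diff)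
  finally have *: "((x' - x) - w * ((x' + p') - (x + p)))\<^sup>2 / s'
      \<le> 2 * (((1 - w) * (x' - x))\<^sup>2 / s') + 2 * ((w * (p' - p))\<^sup>2 / s')"
    using s'(1) by (simp add: divide_right_mono add_divide_distrib[symmetric])
  have \<delta>: "1 / (row_sum v k * col_sum v l) \<le> ?\<delta>" "1 / (tot v)\<^sup>2 \<le> ?\<delta>"
    using clock_drop_ge(1) inverse_tot_sq_le assms(1) by blast+
  have \<delta>0: "0 \<le> ?\<delta>" by (rule order_trans[OF _ \<delta>(2)]) simp
  \<comment> \<open>Each bound enters twice, so the total constant is
    \<open>2 * 2 + 2 * 16 = 36\<close>.\<close>
  have "((1 - w) * (x' - x))\<^sup>2 / s' \<le> 2 * ?\<delta> \<and> (w * (p' - p))\<^sup>2 / s' \<le> 16 * ?\<delta>"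
  proof (cases "i = k \<and> j = l")
    case True
    \<comment> \<open>On the reinforced edge the increments are not small relative to
      \<open>x\<close> and \<open>p\<close>. The factor \<open>(1 - w)^2 \<le> p / x\<close>
      compensates a small \<open>x\<close>, and both quotients reduce to multiples of
      \<open>1 / (T^k * T^l)\<close>.\<close>
    have pV: "p = (real (v k l))\<^sup>2 / (row_sum v k * col_sum v l)" "x = real (v k l) / tot v"
      using True by (simp_all add: p_def x_def succ_prob_def share_def)
    have dx: "0 \<le> x' - x" "x' - x \<le> 1 / tot v"
      using share_bump[OF assms(1), of k l i j] True xp pos(3)
      by (simp_all add: x_def x'_def frac_le)
    have dp: "0 \<le> p' - p" "p' - p \<le> 3 * real (v k l) / (row_sum v k * col_sum v l)"
      using succ_prob_bump_self[OF assms(1), of k l] True by (auto simp: p_def p'_def)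
    have "1 - w \<le> p / x" using xp by (auto simp: w(3) intro!: divide_left_mono)
    moreover have "(1 - w)\<^sup>2 \<le> 1 - w"
      unfolding power2_eq_square using w(1,2) by (intro mult_left_le) auto
    ultimately have "(1 - w)\<^sup>2 \<le> p / x" by linarith
    then have "(1 - w)\<^sup>2 * (x' - x)\<^sup>2 / s' \<le> (p / x) * (1 / tot v)\<^sup>2 / x"
      using dx xp s' by (intro frac_le mult_mono power_mono) auto
    also have "\<dots> = 1 / (row_sum v k * col_sum v l)"
      using pos ge(1)[of k l] by (simp add: pV power2_eq_square)
    finally have 1: "((1 - w) * (x' - x))\<^sup>2 / s' \<le> ?\<delta>" using \<delta>(1) by (simp add: power_mult_distrib)
    have "w\<^sup>2 * (p' - p)\<^sup>2 / s' \<le> 1 * (3 * real (v k l) / (row_sum v k * col_sum v l))\<^sup>2 / p"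
      using dp xp s' w by (intro frac_le mult_mono power_mono power_le_one) auto
    also have "\<dots> = 9 * (1 / (row_sum v k * col_sum v l))"
      using pos ge(1)[of k l] by (simp add: pV power2_eq_square)
    finally have "(w * (p' - p))\<^sup>2 / s' \<le> 9 * ?\<delta>" using \<delta>(1) by (simp add: power_mult_distrib)
    then show ?thesis using 1 \<delta>0 by argo
  next
    case False
    \<comment> \<open>On all other edges the increments are proportional to \<open>x\<close> and
      \<open>p\<close> themselves, so division by the denominator leaves a bounded factor times a
      squared reciprocal.\<close>
    have "\<bar>x' - x\<bar> = x / (tot v + 1)"
      using share_bump[OF assms(1), of k l i j] False xp pos(3)
      by (auto simp: x_def x'_def abs_div)
    also have "\<dots> \<le> x / tot v" using xp pos(3) by (intro divide_left_mono) auto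
    finally have "\<bar>x' - x\<bar> \<le> x / tot v" .
    then have "\<bar>(1 - w) * (x' - x)\<bar> \<le> 1 * (x / tot v)"
      unfolding abs_mult using w(1,2) by (intro mult_mono) auto
    then have "((1 - w) * (x' - x))\<^sup>2 \<le> (x / tot v)\<^sup>2"
      by (simp add: abs_le_square_iff[symmetric] xp pos less_imp_le)
    moreover have "x / 2 \<le> s'" using share_bump_ge(1)[OF assms(1), of i j k l] s' by (simp add: x_def x'_def)
    ultimately have "((1 - w) * (x' - x))\<^sup>2 / s' \<le> (x / tot v)\<^sup>2 / (x / 2)"
      using xp by (intro frac_le) auto
    also have "\<dots> = 2 * x * (1 / (tot v)\<^sup>2)" using xp by (simp add: power2_eq_square)
    also have "\<dots> \<le> 2 * 1 * ?\<delta>" using xp \<delta> \<delta>0 by (intro mult_mono) auto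
    finally have 1: "((1 - w) * (x' - x))\<^sup>2 / s' \<le> 2 * ?\<delta>" by simp
    define e where "e = 1 / row_sum v k + 1 / col_sum v l"
    have e: "0 < 1 / row_sum v k" "0 < 1 / col_sum v l" using pos by auto
    have "p' \<le> p" using succ_prob_bump_other[OF assms(1)] False by (auto simp: p_def p'_def)
    moreover have "p - p' \<le> p * e"
      using succ_prob_bump_ge[OF assms(1), of i k j l] False
        divide_pos_pos[OF xp(2) pos(1)[of k]] divide_pos_pos[OF xp(2) pos(2)[of l]]
      by (auto simp: p_def p'_def e_def distrib_left split: if_splits)
    ultimately have "\<bar>p' - p\<bar> \<le> p * e" by simp
    then have "\<bar>w * (p' - p)\<bar> \<le> 1 * (p * e)"
      unfolding abs_mult using w by (intro mult_mono) auto
    then have "(w * (p' - p))\<^sup>2 \<le> (p * e)\<^sup>2"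
      using xp e by (simp add: abs_le_square_iff[symmetric] e_def abs_mult)
    moreover have "p / 4 \<le> s'" using share_bump_ge(2)[OF assms(1), of i j k l] s' by (simp add: p_def p'_def)
    ultimately have "(w * (p' - p))\<^sup>2 / s' \<le> (p * e)\<^sup>2 / (p / 4)"
      using xp by (intro frac_le) auto
    also have "\<dots> = 4 * p * e\<^sup>2" using xp by (simp add: power2_eq_square)
    also have "\<dots> \<le> 4 * 1 * (4 * ?\<delta>)"
      using xp clock_drop_ge(2)[OF assms(1), of k l] by (intro mult_mono) (auto simp: e_def)
    finally show ?thesis using 1 by simp
  qed
  then show ?thesis using * unfolding w_def[symmetric] s'_def[symmetric] by linarith
qed

section \<open>The Jensen gap and the drift caused by the shares\<close>

lemma sum_share: "all_positive v \<Longrightarrow> (\<Sum>i\<in>UNIV. \<Sum>j\<in>UNIV. share v i j) = 1"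
  using all_positive_gt_0(3)[of v]
  by (simp add: share_def sum_divide_distrib[symmetric] row_sum_def[symmetric] tot_def[symmetric])

lemma potential_nonneg: "0 \<le> potential v"
  by (simp add: potential_def sum_nonneg succ_prob_nonneg)

text \<open>Expanding a square gives \<open>x_ij^2 / (x_i * x_j) \<ge> 2 * x_ij - x_i * x_j\<close>,
  and the right sides sum to \<open>2 - 1\<close>.\<close>

lemma potential_ge_1:
  assumes "all_positive v" shows "1 \<le> potential v"
proof -
  note pos = all_positive_gt_0[OF assms]
  have "2 * share v i j - row_sum v i * col_sum v j / (tot v)\<^sup>2 \<le> succ_prob v i j" for i j
  proof -
    define a where "a = row_sum v i * col_sum v j"
    have a: "0 < a" "0 < tot v" using pos by (auto simp: a_def)
    have "succ_prob v i j - (2 * share v i j - a / (tot v)\<^sup>2) = (real (v i j) - a / tot v)\<^sup>2 / a"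
      using a unfolding succ_prob_def share_def a_def[symmetric]
      by (simp add: field_simps power2_eq_square)
    moreover have "0 \<le> (real (v i j) - a / tot v)\<^sup>2 / a" using a by simp
    ultimately show ?thesis unfolding a_def by linarith
  qed
  then have "(\<Sum>i\<in>UNIV. \<Sum>j\<in>UNIV. 2 * share v i j - row_sum v i * col_sum v j / (tot v)\<^sup>2) \<le> potential v"
    unfolding potential_def by (intro sum_mono)
  moreover have "(\<Sum>i\<in>UNIV. \<Sum>j\<in>UNIV. row_sum v i * col_sum v j / (tot v)\<^sup>2) = 1"
    using pos(3)
    by (simp add: sum_divide_distrib[symmetric] sum_distrib_left[symmetric] sum_distrib_right[symmetric]
        tot_col[symmetric] tot_def[symmetric] power2_eq_square)
  ultimately show ?thesis
    using sum_share[OF assms] by (simp add: sum_subtractf sum_distrib_left[symmetric])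
qed

text \<open>Each summand is what remains of \<open>1 / (1 + y)\<close> after subtracting its tangent
  at \<open>h\<close>. The tangent parts average to \<open>1 / (1 + h)\<close> because the mean of
  \<open>y\<close> under the shares is \<open>h\<close>.\<close>

lemma gap_eq:
  assumes "all_positive v"
  shows "gap v = (\<Sum>i\<in>UNIV. \<Sum>j\<in>UNIV. share v i j * (tot v * ratio v i j - potential v)\<^sup>2
    / ((1 + tot v * ratio v i j) * (1 + potential v)\<^sup>2))"
proof -
  define h where "h = potential v"
  have h: "0 < 1 + h" using potential_nonneg[of v] by (simp add: h_def)
  define y where "y i j = tot v * ratio v i j" for i j
  have y: "0 < 1 + y i j" for i j
    using tot_ratio_nonneg[of v i j] by (simp add: y_def)
  have "(share v i j)\<^sup>2 / (share v i j + succ_prob v i j)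
      = share v i j * (y i j - h)\<^sup>2 / ((1 + y i j) * (1 + h)\<^sup>2)
        + share v i j * (1 / (1 + h) + h / (1 + h)\<^sup>2) - succ_prob v i j / (1 + h)\<^sup>2" for i j
  proof -
    have "(share v i j)\<^sup>2 / (share v i j + succ_prob v i j) = share v i j * (1 / (1 + y i j))"
      unfolding y_def weight_eq(1)[OF assms, symmetric] by (simp add: power2_eq_square)
    moreover have "1 / (1 + y i j) = (y i j - h)\<^sup>2 / ((1 + y i j) * (1 + h)\<^sup>2)
        + (1 / (1 + h) + h / (1 + h)\<^sup>2) - y i j / (1 + h)\<^sup>2"
      using h y[of i j] by (simp add: divide_simps power2_eq_square) (simp add: algebra_simps)
    ultimately show ?thesis
      by (simp only: weight_eq(2)[OF assms, of i j] y_def[symmetric] distrib_left right_diff_distrib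
          times_divide_eq_right)
  qed
  then have "convex_sum v = (\<Sum>i\<in>UNIV. \<Sum>j\<in>UNIV. share v i j * (y i j - h)\<^sup>2 / ((1 + y i j) * (1 + h)\<^sup>2))
      + (1 / (1 + h) + h / (1 + h)\<^sup>2) - h / (1 + h)\<^sup>2"
    using sum_share[OF assms]
    by (simp add: convex_sum_def sum.distrib sum_subtractf sum_divide_distrib[symmetric]
        sum_distrib_right[symmetric] potential_def[symmetric] h_def[symmetric])
  then show ?thesis by (simp add: gap_def y_def h_def)
qed

lemma gap_nonneg:
  assumes "all_positive v" shows "0 \<le> gap v"
  unfolding gap_eq[OF assms]
  by (intro sum_nonneg divide_nonneg_nonneg mult_nonneg_nonneg add_nonneg_nonneg zero_le_power2
      tot_ratio_nonneg less_imp_le[OF share_pos[OF assms]]) simp_all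

text \<open>The averaged change of \<open>x_ij\<close> is
  \<open>x_ij * (y_ij - h) / (tot v + 1)\<close>, the mean field in discrete time. Its coefficient,
  the partial derivative of \<open>x^2 / (x + p)\<close> in \<open>x\<close>, decreases in
  \<open>y\<close>, so the two are negatively correlated.\<close>

lemma share_drift_le:
  assumes "all_positive v"
  shows "(\<Sum>k\<in>UNIV. \<Sum>l\<in>UNIV. succ_prob v k l * (\<Sum>i\<in>UNIV. \<Sum>j\<in>UNIV.
      (2 * (1 / (1 + tot v * ratio v i j)) - (1 / (1 + tot v * ratio v i j))\<^sup>2)
        * (share (bump v k l) i j - share v i j))) \<le> - gap v / (tot v + 1)"
proof -
  define h where "h = potential v"
  have h: "1 \<le> h" using potential_ge_1[OF assms] by (simp add: h_def)
  define y where "y i j = tot v * ratio v i j" for i j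
  have y: "0 \<le> y i j" for i j
    using tot_ratio_nonneg[of v i j] by (simp add: y_def)
  define g where "g t = 2 * (1 / (1 + t)) - (1 / (1 + t))\<^sup>2" for t :: real
  have T: "0 < tot v + 1" using all_positive_gt_0(3)[OF assms] by simp
  have term_le: "(g t - g h) * (t - h) \<le> - ((t - h)\<^sup>2 / ((1 + t) * (1 + h)\<^sup>2))" if t: "0 \<le> t" for t
  proof -
    define w W where "w = 1 / (1 + t)" and "W = 1 / (1 + h)"
    \<comment> \<open>From \<open>w \<le> 1\<close> and \<open>W \<le> 1/2\<close>; the latter is
      where \<open>1 \<le> h\<close> enters.\<close>
    have le: "W \<le> 2 - w - W"
      using t h by (simp add: w_def W_def) (smt (verit) divide_le_eq_1 field_sum_of_halves frac_le)
    have d: "w - W = (h - t) * (w * W)"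
      using t h by (simp add: w_def W_def field_simps)
    have "(g t - g h) * (t - h) = (w - W) * (2 - w - W) * (t - h)"
      by (simp add: g_def w_def[symmetric] W_def[symmetric] algebra_simps power2_eq_square)
    also have "\<dots> = - ((t - h)\<^sup>2 * (w * W) * (2 - w - W))"
      by (simp add: d power2_eq_square algebra_simps)
    also have "\<dots> \<le> - ((t - h)\<^sup>2 * (w * W) * W)"
      using mult_left_mono[OF le, of "(t - h)\<^sup>2 * (w * W)"] t h by (simp only: w_def W_def) simp
    also have "\<dots> = - ((t - h)\<^sup>2 / ((1 + t) * (1 + h)\<^sup>2))"
      by (simp add: w_def W_def power2_eq_square)
    finally show ?thesis .
  qed
  have "(\<Sum>k\<in>UNIV. \<Sum>l\<in>UNIV. succ_prob v k l * (\<Sum>i\<in>UNIV. \<Sum>j\<in>UNIV. g (y i j) * (share (bump v k l) i j - share v i j)))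
      = (\<Sum>i\<in>UNIV. \<Sum>j\<in>UNIV. \<Sum>k\<in>UNIV. \<Sum>l\<in>UNIV. succ_prob v k l * (g (y i j) * (share (bump v k l) i j - share v i j)))"
    unfolding sum_distrib_left by (rule sum4_swap)
  also have "\<dots> = (\<Sum>i\<in>UNIV. \<Sum>j\<in>UNIV. g (y i j) / (tot v + 1) * (\<Sum>k\<in>UNIV. \<Sum>l\<in>UNIV.
      succ_prob v k l * (if i = k \<and> j = l then 1 else 0) - succ_prob v k l * share v i j))"
    unfolding sum_distrib_left share_bump[OF assms]
    by (intro sum.cong refl) (simp add: algebra_simps diff_divide_distrib)
  also have "\<dots> = (\<Sum>i\<in>UNIV. \<Sum>j\<in>UNIV. g (y i j) / (tot v + 1) * (succ_prob v i j - h * share v i j))"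
    unfolding sum_subtractf sum_delta_pair sum_distrib_right[symmetric] potential_def[symmetric] h_def by simp
  also have "\<dots> = (\<Sum>i\<in>UNIV. \<Sum>j\<in>UNIV. (g (y i j) - g h) * (succ_prob v i j - h * share v i j)) / (tot v + 1)"
  proof -
    \<comment> \<open>The mean field has total mass zero, so a constant may be subtracted from the
      coefficients.\<close>
    have "(\<Sum>i\<in>UNIV. \<Sum>j\<in>UNIV. g h * (succ_prob v i j - h * share v i j)) = 0"
      using sum_share[OF assms]
      by (simp add: sum_distrib_left[symmetric] sum_subtractf potential_def[symmetric] h_def[symmetric])
    then show ?thesis
      by (simp add: left_diff_distrib sum_subtractf sum_divide_distrib)
  qed
  also have "\<dots> \<le> (\<Sum>i\<in>UNIV. \<Sum>j\<in>UNIV. - (share v i j * (y i j - h)\<^sup>2 / ((1 + y i j) * (1 + h)\<^sup>2))) / (tot v + 1)"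
  proof (intro divide_right_mono sum_mono)
    fix i j
    have "(g (y i j) - g h) * (succ_prob v i j - h * share v i j) = share v i j * ((g (y i j) - g h) * (y i j - h))"
      by (simp add: weight_eq(2)[OF assms] y_def algebra_simps)
    also have "\<dots> \<le> share v i j * - ((y i j - h)\<^sup>2 / ((1 + y i j) * (1 + h)\<^sup>2))"
      using share_pos[OF assms, of i j] by (intro mult_left_mono term_le y) auto
    finally show "(g (y i j) - g h) * (succ_prob v i j - h * share v i j)
        \<le> - (share v i j * (y i j - h)\<^sup>2 / ((1 + y i j) * (1 + h)\<^sup>2))" by simp
  qed (use T in auto)
  also have "\<dots> = - gap v / (tot v + 1)"
    by (simp add: gap_eq[OF assms] sum_negf y_def h_def)
  finally show ?thesis by (simp add: g_def y_def)
qed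

text \<open>Only the type of the argument matters.\<close>

abbreviation cells :: "('a::finite \<Rightarrow> 'b::finite \<Rightarrow> nat) \<Rightarrow> real" where
  "cells v \<equiv> real CARD('a) * real CARD('b)"

text \<open>Expand every summand around the old state. With \<open>w = 1 / (1 + y)\<close> its
  partial derivatives in \<open>x\<close> and \<open>p\<close> are \<open>2 * w - w^2\<close> and
  \<open>- w^2\<close>; the remainders add up to 36 clock decreases per cell.\<close>

lemma convex_sum_bump_le:
  assumes "all_positive (v :: 'a::finite \<Rightarrow> 'b::finite \<Rightarrow> nat)"
  shows "convex_sum (bump v k l) - convex_sum v \<le>
    (\<Sum>i\<in>UNIV. \<Sum>j\<in>UNIV. (2 * (1 / (1 + tot v * ratio v i j)) - (1 / (1 + tot v * ratio v i j))\<^sup>2)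
        * (share (bump v k l) i j - share v i j))
    - (\<Sum>i\<in>UNIV. \<Sum>j\<in>UNIV. 1 / (1 + tot v * ratio v i j)\<^sup>2 * (succ_prob (bump v k l) i j - succ_prob v i j))
    + 36 * cells v * (clock v - clock (bump v k l))" (is "_ \<le> ?A - ?B + ?C")
proof -
  have "convex_sum (bump v k l) - convex_sum v
      \<le> (\<Sum>i\<in>UNIV. \<Sum>j\<in>UNIV. (2 * (1 / (1 + tot v * ratio v i j)) - (1 / (1 + tot v * ratio v i j))\<^sup>2)
        * (share (bump v k l) i j - share v i j)
      - 1 / (1 + tot v * ratio v i j)\<^sup>2 * (succ_prob (bump v k l) i j - succ_prob v i j)
      + 36 * (clock v - clock (bump v k l)))"
    unfolding convex_sum_def sum_subtractf[symmetric]
  proof (intro sum_mono)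
    fix i j
    define x p x' p' where "x = share v i j" and "p = succ_prob v i j"
      and "x' = share (bump v k l) i j" and "p' = succ_prob (bump v k l) i j"
    have xp: "0 < x" "0 < p" "0 < x'" "0 < p'"
      using share_pos[OF assms] succ_prob_pos[OF assms]
        share_pos[OF all_positive_bump[OF assms]] succ_prob_pos[OF all_positive_bump[OF assms]]
      by (simp_all add: x_def p_def x'_def p'_def)
    define w where "w = x / (x + p)"
    have w: "1 / (1 + tot v * ratio v i j) = w"
      using weight_eq(1)[OF assms] by (simp add: w_def x_def p_def)
    have "x'\<^sup>2 / (x' + p') - x\<^sup>2 / (x + p) \<le> 2 * w * (x' - x) - w\<^sup>2 * ((x' + p') - (x + p))
        + 36 * (clock v - clock (bump v k l))"
      using quad_over_linear[of "x + p" "x' + p'" x' x] quad_remainder_le[OF assms, of k l i j] xp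
      unfolding w_def x_def p_def x'_def p'_def by auto
    also have "2 * w * (x' - x) - w\<^sup>2 * ((x' + p') - (x + p)) = (2 * w - w\<^sup>2) * (x' - x) - w\<^sup>2 * (p' - p)"
      by (simp add: algebra_simps)
    finally show "(share (bump v k l) i j)\<^sup>2 / (share (bump v k l) i j + succ_prob (bump v k l) i j) -
        (share v i j)\<^sup>2 / (share v i j + succ_prob v i j)
       \<le> (2 * (1 / (1 + tot v * ratio v i j)) - (1 / (1 + tot v * ratio v i j))\<^sup>2) *
           (share (bump v k l) i j - share v i j) -
          1 / (1 + tot v * ratio v i j)\<^sup>2 * (succ_prob (bump v k l) i j - succ_prob v i j) +
          36 * (clock v - clock (bump v k l))"
      unfolding power_one_over[symmetric] w x_def p_def x'_def p'_def .
  qed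
  also have "\<dots> = ?A - ?B + ?C"
    by (simp add: sum.distrib sum_subtractf)
  finally show ?thesis .
qed

lemma drift_convex_sum_le:
  assumes "all_positive (v :: 'a::finite \<Rightarrow> 'b::finite \<Rightarrow> nat)"
  shows "drift convex_sum v \<le> - gap v / (tot v + 1) + dispersion v - (36 * cells v + 4) * drift clock v"
proof -
  have "drift convex_sum v \<le> (\<Sum>k\<in>UNIV. \<Sum>l\<in>UNIV. succ_prob v k l *
    ((\<Sum>i\<in>UNIV. \<Sum>j\<in>UNIV. (2 * (1 / (1 + tot v * ratio v i j)) - (1 / (1 + tot v * ratio v i j))\<^sup>2)
        * (share (bump v k l) i j - share v i j))
    - (\<Sum>i\<in>UNIV. \<Sum>j\<in>UNIV. 1 / (1 + tot v * ratio v i j)\<^sup>2 * (succ_prob (bump v k l) i j - succ_prob v i j))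
    + 36 * cells v * (clock v - clock (bump v k l))))"
    unfolding drift_def
    by (intro sum_mono mult_left_mono convex_sum_bump_le assms succ_prob_nonneg)
  also have "\<dots> = (\<Sum>k\<in>UNIV. \<Sum>l\<in>UNIV. succ_prob v k l *
    (\<Sum>i\<in>UNIV. \<Sum>j\<in>UNIV. (2 * (1 / (1 + tot v * ratio v i j)) - (1 / (1 + tot v * ratio v i j))\<^sup>2)
        * (share (bump v k l) i j - share v i j)))
    - (\<Sum>k\<in>UNIV. \<Sum>l\<in>UNIV. succ_prob v k l *
       (\<Sum>i\<in>UNIV. \<Sum>j\<in>UNIV. 1 / (1 + tot v * ratio v i j)\<^sup>2 * (succ_prob (bump v k l) i j - succ_prob v i j)))
    + (\<Sum>k\<in>UNIV. \<Sum>l\<in>UNIV. succ_prob v k l * (36 * cells v * (clock v - clock (bump v k l))))"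
    by (simp only: distrib_left right_diff_distrib[of "succ_prob v _ _" "sum _ _"] sum.distrib sum_subtractf)
  also have "(\<Sum>k\<in>UNIV. \<Sum>l\<in>UNIV. succ_prob v k l * (36 * cells v * (clock v - clock (bump v k l))))
      = - (36 * cells v) * drift clock v"
    unfolding drift_def sum_distrib_left by (intro sum.cong refl) (simp add: algebra_simps)
  finally show ?thesis
    using share_drift_le[OF assms] damped_drift_ge[OF assms] by (simp add: algebra_simps)
qed

text \<open>The multiples of \<open>clock\<close> here and below absorb the second-order terms.\<close>

definition lyapunov :: "('a::finite \<Rightarrow> 'b::finite \<Rightarrow> nat) \<Rightarrow> real" where
  "lyapunov v = convex_sum v - potential v + (36 * cells v + 8) * clock v"

definition adjusted_potential :: "('a::finite \<Rightarrow> 'b::finite \<Rightarrow> nat) \<Rightarrow> real" where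
  "adjusted_potential v = potential v - 4 * clock v"

text \<open>The \<open>dispersion\<close> terms of \<open>convex_sum\<close> and
  \<open>potential\<close> cancel. The clock errors \<open>36 * cells v + 4\<close> and
  \<open>4\<close> are matched exactly by the coefficient of \<open>clock\<close> in
  \<open>lyapunov\<close>.\<close>

lemma drift_lyapunov_le:
  assumes "all_positive v" shows "drift lyapunov v \<le> - gap v / (tot v + 1)"
proof -
  have "drift lyapunov v = drift convex_sum v - drift potential v + (36 * cells v + 8) * drift clock v"
    unfolding lyapunov_def[abs_def] drift_linear ..
  then show ?thesis
    using drift_convex_sum_le[OF assms] drift_potential_ge[OF assms] by (simp add: algebra_simps)
qed

lemma drift_adjusted_potential_nonneg:
  assumes "all_positive v" shows "0 \<le> drift adjusted_potential v"
  using drift_potential_ge[OF assms] dispersion_nonneg[of v]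
  unfolding adjusted_potential_def[abs_def] drift_linear by linarith

section \<open>Increment bounds for the compensated functions\<close>

text \<open>The bound is chosen so that the squared increment is at most \<open>4 * c^2\<close>
  times the decrease of \<open>clock\<close>.\<close>

definition tame :: "(('a::finite \<Rightarrow> 'b::finite \<Rightarrow> nat) \<Rightarrow> real) \<Rightarrow> bool" where
  "tame g \<longleftrightarrow> (\<exists>c\<ge>0. \<forall>v k l. all_positive v \<longrightarrow> \<bar>g (bump v k l) - g v\<bar> \<le> c * (1 / row_sum v k + 1 / col_sum v l))"

lemma tame_add:
  assumes "tame f" "tame g" shows "tame (\<lambda>v. f v + g v)"
proof -
  obtain c d where cd: "0 \<le> c" "0 \<le> d"
    "\<And>v k l. all_positive v \<Longrightarrow> \<bar>f (bump v k l) - f v\<bar> \<le> c * (1 / row_sum v k + 1 / col_sum v l)"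
    "\<And>v k l. all_positive v \<Longrightarrow> \<bar>g (bump v k l) - g v\<bar> \<le> d * (1 / row_sum v k + 1 / col_sum v l)"
    using assms unfolding tame_def by metis
  have "\<bar>f (bump v k l) + g (bump v k l) - (f v + g v)\<bar> \<le> (c + d) * (1 / row_sum v k + 1 / col_sum v l)"
    if "all_positive v" for v k l
    using cd(3,4)[OF that, of k l] unfolding distrib_right[of c d] by linarith
  then show ?thesis unfolding tame_def using cd by (intro exI[of _ "c + d"]) auto
qed

lemma tame_cmult:
  assumes "tame f" shows "tame (\<lambda>v. a * f v)"
proof -
  obtain c where c: "0 \<le> c"
    "\<And>v k l. all_positive v \<Longrightarrow> \<bar>f (bump v k l) - f v\<bar> \<le> c * (1 / row_sum v k + 1 / col_sum v l)"
    using assms unfolding tame_def by metis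
  have "\<bar>a * f (bump v k l) - a * f v\<bar> \<le> (\<bar>a\<bar> * c) * (1 / row_sum v k + 1 / col_sum v l)"
    if "all_positive v" for v k l
    using mult_left_mono[OF c(2)[OF that, of k l], of "\<bar>a\<bar>"]
    by (simp only: right_diff_distrib[symmetric] abs_mult abs_ge_zero mult.assoc)
  then show ?thesis unfolding tame_def using c by (intro exI[of _ "\<bar>a\<bar> * c"]) auto
qed

lemma tame_sum:
  assumes "\<And>i. tame (f i)" shows "tame (\<lambda>v. \<Sum>i\<in>(UNIV :: 'c::finite set). f i v)"
proof -
  have "tame (\<lambda>v. \<Sum>i\<in>S. f i v)" if "finite S" for S :: "'c set"
    using that
  proof induction
    case empty
    then show ?case by (auto simp: tame_def intro!: exI[of _ 0])
  next
    case (insert i S)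
    then show ?case using tame_add[OF assms[of i] insert.IH] by simp
  qed
  then show ?thesis by simp
qed

lemma tame_clock: "tame clock"
  unfolding tame_def
proof (intro exI[of _ 1] conjI allI impI)
  fix v :: "'a::finite \<Rightarrow> 'b::finite \<Rightarrow> nat" and k l assume v: "all_positive v"
  have a: "0 \<le> 1 / (r * (r + 1)) \<and> 1 / (r * (r + 1)) \<le> 1 / r" if "1 \<le> r" for r :: real
    using that by (auto intro!: divide_left_mono simp: mult_ge1_I)
  show "\<bar>clock (bump v k l) - clock v\<bar> \<le> 1 * (1 / row_sum v k + 1 / col_sum v l)"
    using a[OF all_positive_ge_1(2)[OF v, of k]] a[OF all_positive_ge_1(3)[OF v, of l]] clock_drop[OF v, of k l]
    unfolding mult_1 abs_le_iff by argo
qed simp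

lemma tame_succ_prob: "tame (\<lambda>v. succ_prob v i j)"
  unfolding tame_def using succ_prob_bump_abs by (intro exI[of _ 3]) auto

text \<open>Both partial derivatives lie in \<open>[-1, 1]\<close>. Convexity gives the lower bound,
  and exchanging the two points gives the upper one.\<close>

lemma quad_over_linear_abs:
  fixes x p x' p' :: real
  assumes "0 < x" "0 < p" "0 < x'" "0 < p'"
  shows "\<bar>x'\<^sup>2 / (x' + p') - x\<^sup>2 / (x + p)\<bar> \<le> \<bar>x' - x\<bar> + \<bar>p' - p\<bar>"
proof -
  have lower: "- (\<bar>x' - x\<bar> + \<bar>p' - p\<bar>) \<le> x'\<^sup>2 / (x' + p') - x\<^sup>2 / (x + p)"
    if "0 < x" "0 < p" "0 < x'" "0 < p'" for x p x' p' :: real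
  proof -
    define w where "w = x / (x + p)"
    have w: "0 \<le> w" "w \<le> 1" using that by (auto simp: w_def)
    have w2: "0 \<le> w\<^sup>2" "w\<^sup>2 \<le> 1" "0 \<le> 2 * w - w\<^sup>2" "2 * w - w\<^sup>2 \<le> 1"
      using w zero_le_power2[of "1 - w"] mult_left_le[of w w]
      by (simp_all add: power_le_one power2_diff) (simp_all add: power2_eq_square)
    have "\<bar>(2 * w - w\<^sup>2) * (x' - x)\<bar> \<le> 1 * \<bar>x' - x\<bar>" "\<bar>w\<^sup>2 * (p' - p)\<bar> \<le> 1 * \<bar>p' - p\<bar>"
      unfolding abs_mult using w2 by (intro mult_right_mono; simp)+
    then have "- \<bar>x' - x\<bar> \<le> (2 * w - w\<^sup>2) * (x' - x)" "w\<^sup>2 * (p' - p) \<le> \<bar>p' - p\<bar>"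
      by (simp_all only: abs_le_iff minus_le_iff mult_1)
    moreover have "x'\<^sup>2 / (x' + p') - x\<^sup>2 / (x + p) \<ge> 2 * w * (x' - x) - w\<^sup>2 * ((x' + p') - (x + p))"
      using quad_over_linear[of "x + p" "x' + p'" x' x] that unfolding w_def by simp
    moreover have "2 * w * (x' - x) - w\<^sup>2 * ((x' + p') - (x + p)) = (2 * w - w\<^sup>2) * (x' - x) - w\<^sup>2 * (p' - p)"
      by (simp add: algebra_simps)
    ultimately show ?thesis by argo
  qed
  show ?thesis using lower[OF assms] lower[OF assms(3,4,1,2)] by (simp add: abs_le_iff abs_minus_commute)
qed

lemma tame_quad: "tame (\<lambda>v. (share v i j)\<^sup>2 / (share v i j + succ_prob v i j))"
  unfolding tame_def
\<comment> \<open>The constant is 1 for the share, which moves by at most \<open>1 / T^k\<close>,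
  plus 3 for the success probability.\<close>
proof (intro exI[of _ 4] conjI allI impI)
  fix v :: "'a::finite \<Rightarrow> 'b::finite \<Rightarrow> nat" and k l assume v: "all_positive v"
  let ?v = "bump v k l"
  have "\<bar>(if i = k \<and> j = l then 1 else 0) - share v i j\<bar> \<le> 1"
    using share_pos[OF v, of i j] share_le_1[OF v, of i j] by auto
  then have "\<bar>share ?v i j - share v i j\<bar> \<le> 1 / row_sum v k"
    using all_positive_gt_0(1)[OF v, of k] row_le_tot[of v k] unfolding share_bump[OF v] abs_divide
    by (intro frac_le) auto
  moreover have "0 < 1 / col_sum v l" using all_positive_gt_0(2)[OF v] by simp
  ultimately show "\<bar>(share ?v i j)\<^sup>2 / (share ?v i j + succ_prob ?v i j) - (share v i j)\<^sup>2 / (share v i j + succ_prob v i j)\<bar>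
    \<le> 4 * (1 / row_sum v k + 1 / col_sum v l)"
    using quad_over_linear_abs[OF share_pos[OF v, of i j] succ_prob_pos[OF v, of i j]
        share_pos[OF all_positive_bump[OF v], of k l i j]
        succ_prob_pos[OF all_positive_bump[OF v], of k l i j]] succ_prob_bump_abs[OF v, of k l i j]
    unfolding distrib_left by argo
qed simp

lemma tame_potential: "tame potential"
  unfolding potential_def[abs_def] by (intro tame_sum tame_succ_prob)

lemma tame_adjusted_potential: "tame adjusted_potential"
  using tame_add[OF tame_potential tame_cmult[OF tame_clock, of "-4"]]
  by (simp add: adjusted_potential_def[abs_def])

lemma tame_lyapunov: "tame (lyapunov :: ('a::finite \<Rightarrow> 'b::finite \<Rightarrow> nat) \<Rightarrow> real)"
proof -
  have "tame (convex_sum :: ('a \<Rightarrow> 'b \<Rightarrow> nat) \<Rightarrow> real)"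
    unfolding convex_sum_def[abs_def] by (intro tame_sum tame_quad)
  from tame_add[OF tame_add[OF this tame_cmult[OF tame_potential, of "-1"]]
      tame_cmult[OF tame_clock, of "36 * (real CARD('a) * real CARD('b)) + 8"]]
  show ?thesis by (simp add: lyapunov_def[abs_def])
qed


section \<open>Convergence of square-summable martingales\<close>

text \<open>The martingale difference property is stated weakly, as orthogonality to all bounded
  \<open>F n\<close>-measurable variables. This is the form in which the cross terms appear.\<close>

locale l2_martingale = prob_space M for M :: "'w measure" +
  fixes F :: "nat \<Rightarrow> 'w measure" and \<xi> :: "nat \<Rightarrow> 'w \<Rightarrow> real" and B :: real
  assumes sub: "\<And>n. subalgebra M (F n)"
    and F_mono: "\<And>m n. m \<le> n \<Longrightarrow> subalgebra (F n) (F m)"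
    and \<xi>_meas: "\<And>n. \<xi> n \<in> borel_measurable (F (Suc n))"
    and \<xi>_bounded: "\<And>n. \<exists>b. AE \<omega> in M. \<bar>\<xi> n \<omega>\<bar> \<le> b"
    and orthogonal: "\<And>n Z b. Z \<in> borel_measurable (F n) \<Longrightarrow> AE \<omega> in M. \<bar>Z \<omega>\<bar> \<le> b \<Longrightarrow>
       (\<integral>\<omega>. Z \<omega> * \<xi> n \<omega> \<partial>M) = 0"
    and second_moments: "\<And>N. (\<Sum>n<N. \<integral>\<omega>. (\<xi> n \<omega>)\<^sup>2 \<partial>M) \<le> B"
begin

definition S :: "nat \<Rightarrow> 'w \<Rightarrow> real" where "S n \<omega> = (\<Sum>i<n. \<xi> i \<omega>)"

lemma F_measD: "m \<le> n \<Longrightarrow> f \<in> borel_measurable (F m) \<Longrightarrow> f \<in> borel_measurable (F n)"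
  for f :: "'w \<Rightarrow> real"
  using measurable_from_subalg[OF F_mono] by blast

lemma M_measD: "f \<in> borel_measurable (F m) \<Longrightarrow> f \<in> borel_measurable M"
  for f :: "'w \<Rightarrow> real"
  using measurable_from_subalg[OF sub] by blast

lemma S_meas: "S n \<in> borel_measurable (F n)"
  unfolding S_def[abs_def] by (intro borel_measurable_sum F_measD[OF _ \<xi>_meas]) auto

text \<open>The martingale stopped when it first moves by at least \<open>\<epsilon>\<close> after time \<open>m\<close>.\<close>

definition below :: "real \<Rightarrow> nat \<Rightarrow> nat \<Rightarrow> 'w \<Rightarrow> real" where
  "below \<epsilon> m n \<omega> = (if \<forall>k\<in>{m..n}. \<bar>S k \<omega> - S m \<omega>\<bar> < \<epsilon> then 1 else 0)"

definition stopped :: "real \<Rightarrow> nat \<Rightarrow> nat \<Rightarrow> 'w \<Rightarrow> real" where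
  "stopped \<epsilon> m n \<omega> = (\<Sum>i\<in>{m..<n}. below \<epsilon> m i \<omega> * \<xi> i \<omega>)"

lemma below_meas: "below \<epsilon> m n \<in> borel_measurable (F n)"
proof -
  have "Measurable.pred (F n) (\<lambda>\<omega>. \<forall>k\<in>{m..n}. \<bar>S k \<omega> - S m \<omega>\<bar> < \<epsilon>)"
  proof (intro pred_intros_countable_bounded(4)[OF _] pred_intros_finite)
    show "finite {m..n}" by simp
    fix k assume "k \<in> {m..n}"
    then have [measurable]: "S k \<in> borel_measurable (F n)" "S m \<in> borel_measurable (F n)"
      by (auto intro: F_measD[OF _ S_meas])
    show "Measurable.pred (F n) (\<lambda>\<omega>. \<bar>S k \<omega> - S m \<omega>\<bar> < \<epsilon>)" by measurable
  qed
  then show ?thesis unfolding below_def[abs_def] by (intro measurable_If) auto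
qed

lemma stopped_meas: "stopped \<epsilon> m n \<in> borel_measurable (F n)"
  unfolding stopped_def[abs_def]
  by (intro borel_measurable_sum borel_measurable_times F_measD[OF _ below_meas] F_measD[OF _ \<xi>_meas]) auto

lemma below_abs: "\<bar>below \<epsilon> m n \<omega>\<bar> \<le> 1"
  by (simp add: below_def)

lemma stopped_bounded: "\<exists>b. AE \<omega> in M. \<bar>stopped \<epsilon> m n \<omega>\<bar> \<le> b"
proof -
  obtain b where b: "\<And>i. AE \<omega> in M. \<bar>\<xi> i \<omega>\<bar> \<le> b i" using \<xi>_bounded by metis
  have "AE \<omega> in M. \<forall>i. \<bar>\<xi> i \<omega>\<bar> \<le> b i" using b by (simp add: AE_all_countable)
  then have "AE \<omega> in M. \<bar>stopped \<epsilon> m n \<omega>\<bar> \<le> (\<Sum>i\<in>{m..<n}. 1 * b i)"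
  proof eventually_elim
    case (elim \<omega>)
    have "\<bar>stopped \<epsilon> m n \<omega>\<bar> \<le> (\<Sum>i\<in>{m..<n}. \<bar>below \<epsilon> m i \<omega> * \<xi> i \<omega>\<bar>)"
      unfolding stopped_def by (rule sum_abs)
    also have "\<dots> \<le> (\<Sum>i\<in>{m..<n}. 1 * b i)"
      unfolding abs_mult using elim below_abs by (intro sum_mono mult_mono) auto
    finally show ?case .
  qed
  then show ?thesis by blast
qed

lemma bounded_integrable:
  fixes f :: "'w \<Rightarrow> real"
  assumes "f \<in> borel_measurable M" "AE \<omega> in M. \<bar>f \<omega>\<bar> \<le> b"
  shows "integrable M f"
  using assms by (intro integrable_const_bound[of _ b]) auto

text \<open>Pythagoras: the stopped sum times the indicator is bounded and
  \<open>F n\<close>-measurable, so the cross term vanishes. Multiplying a square by the indicator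
  can only reduce it.\<close>

lemma stopped_second_moment:
  "(\<integral>\<omega>. (stopped \<epsilon> m n \<omega>)\<^sup>2 \<partial>M) \<le> (\<Sum>i\<in>{m..<n}. \<integral>\<omega>. (\<xi> i \<omega>)\<^sup>2 \<partial>M)"
proof (induction n)
  case 0
  then show ?case by (simp add: stopped_def)
next
  case (Suc n)
  show ?case
  proof (cases "m \<le> n")
    case False
    then show ?thesis by (simp add: stopped_def)
  next
    case True
    let ?R = "stopped \<epsilon> m n" and ?I = "below \<epsilon> m n"
    have Suc_eq: "stopped \<epsilon> m (Suc n) \<omega> = ?R \<omega> + ?I \<omega> * \<xi> n \<omega>" for \<omega>
      using True by (simp add: stopped_def)
    obtain b c where b: "AE \<omega> in M. \<bar>?R \<omega>\<bar> \<le> b" and c: "AE \<omega> in M. \<bar>\<xi> n \<omega>\<bar> \<le> c"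
      using stopped_bounded \<xi>_bounded by blast
    have [measurable]: "?R \<in> borel_measurable M" "?I \<in> borel_measurable M" "\<xi> n \<in> borel_measurable M"
      using M_measD stopped_meas below_meas \<xi>_meas by blast+
    have i1: "integrable M (\<lambda>\<omega>. (?R \<omega>)\<^sup>2)"
      by (rule bounded_integrable[of _ "b\<^sup>2"], measurable, use b in eventually_elim)
        (metis abs_ge_zero abs_power2 power2_abs power_mono)
    have i2: "integrable M (\<lambda>\<omega>. (\<xi> n \<omega>)\<^sup>2)"
      by (rule bounded_integrable[of _ "c\<^sup>2"], measurable, use c in eventually_elim)
        (metis abs_ge_zero abs_power2 power2_abs power_mono)
    have ib: "?I \<omega> * ?I \<omega> = ?I \<omega>" "0 \<le> ?I \<omega>" "?I \<omega> \<le> 1" for \<omega> by (auto simp: below_def)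
    have i3: "integrable M (\<lambda>\<omega>. ?I \<omega> * (\<xi> n \<omega>)\<^sup>2)"
      using i2 by (rule Bochner_Integration.integrable_bound) (auto simp: ib abs_mult mult_left_le_one_le)
    have rb: "AE \<omega> in M. \<bar>?R \<omega> * ?I \<omega>\<bar> \<le> b"
      using b
    proof eventually_elim
      case (elim \<omega>)
      have "\<bar>?R \<omega>\<bar> * \<bar>?I \<omega>\<bar> \<le> \<bar>?R \<omega>\<bar>" using ib by (intro mult_left_le) auto
      then show ?case using elim by (simp add: abs_mult)
    qed
    have i4: "integrable M (\<lambda>\<omega>. ?R \<omega> * ?I \<omega> * \<xi> n \<omega>)"
    proof (rule bounded_integrable[of _ "b * c"])
      show "AE \<omega> in M. \<bar>?R \<omega> * ?I \<omega> * \<xi> n \<omega>\<bar> \<le> b * c"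
        using rb c
      proof eventually_elim
        case (elim \<omega>)
        then show ?case unfolding abs_mult[of "_ * _" "\<xi> n \<omega>"] by (intro mult_mono) auto
      qed
    qed measurable
    have "(\<integral>\<omega>. (stopped \<epsilon> m (Suc n) \<omega>)\<^sup>2 \<partial>M)
        = (\<integral>\<omega>. (?R \<omega>)\<^sup>2 + 2 * (?R \<omega> * ?I \<omega> * \<xi> n \<omega>) + ?I \<omega> * (\<xi> n \<omega>)\<^sup>2 \<partial>M)"
    proof (rule Bochner_Integration.integral_cong[OF refl])
      fix \<omega>
      have "(?I \<omega> * \<xi> n \<omega>)\<^sup>2 = ?I \<omega> * (\<xi> n \<omega>)\<^sup>2"
        unfolding power_mult_distrib power2_eq_square[of "?I \<omega>"] ib(1) ..
      then show "(stopped \<epsilon> m (Suc n) \<omega>)\<^sup>2 = (?R \<omega>)\<^sup>2 + 2 * (?R \<omega> * ?I \<omega> * \<xi> n \<omega>) + ?I \<omega> * (\<xi> n \<omega>)\<^sup>2"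
        by (simp add: Suc_eq power2_sum)
    qed
    also have "\<dots> = (\<integral>\<omega>. (?R \<omega>)\<^sup>2 \<partial>M) + 2 * (\<integral>\<omega>. ?R \<omega> * ?I \<omega> * \<xi> n \<omega> \<partial>M) + (\<integral>\<omega>. ?I \<omega> * (\<xi> n \<omega>)\<^sup>2 \<partial>M)"
      using i1 i3 i4 by simp
    also have "(\<integral>\<omega>. ?R \<omega> * ?I \<omega> * \<xi> n \<omega> \<partial>M) = 0"
      by (rule orthogonal[OF borel_measurable_times[OF stopped_meas below_meas] rb])
    also have "(\<integral>\<omega>. ?I \<omega> * (\<xi> n \<omega>)\<^sup>2 \<partial>M) \<le> (\<integral>\<omega>. (\<xi> n \<omega>)\<^sup>2 \<partial>M)"
      using i2 i3 ib by (intro integral_mono) (auto simp: mult_left_le_one_le)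
    finally show ?thesis using Suc.IH True by simp
  qed
qed

text \<open>Kolmogorov's inequality: on the event, the stopped sum is frozen at a value of modulus
  at least \<open>\<epsilon>\<close>, so Markov's inequality for its square applies.\<close>

lemma maximal_inequality:
  assumes "0 < \<epsilon>"
  shows "prob {\<omega> \<in> space M. \<exists>k\<in>{m..n}. \<epsilon> \<le> \<bar>S k \<omega> - S m \<omega>\<bar>}
    \<le> (\<Sum>i\<in>{m..<n}. \<integral>\<omega>. (\<xi> i \<omega>)\<^sup>2 \<partial>M) / \<epsilon>\<^sup>2"
proof -
  let ?R = "stopped \<epsilon> m n"
  have [measurable]: "?R \<in> borel_measurable M" using M_measD stopped_meas by blast
  have "{\<omega> \<in> space M. \<exists>k\<in>{m..n}. \<epsilon> \<le> \<bar>S k \<omega> - S m \<omega>\<bar>} \<subseteq> {\<omega> \<in> space M. \<epsilon>\<^sup>2 \<le> (?R \<omega>)\<^sup>2}"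
  proof safe
    fix \<omega> k assume "k \<in> {m..n}" "\<epsilon> \<le> \<bar>S k \<omega> - S m \<omega>\<bar>"
    then have ex: "\<exists>k. m \<le> k \<and> k \<le> n \<and> \<epsilon> \<le> \<bar>S k \<omega> - S m \<omega>\<bar>" by auto
    \<comment> \<open>At the first exit time \<open>K\<close> the factor \<open>below\<close>
      switches from 1 to 0. The increment \<open>\<xi> (K - 1)\<close> that causes the exit is still
      counted, so the sum ends at \<open>S K - S m\<close>.\<close>
    define K where "K = (LEAST k. m \<le> k \<and> k \<le> n \<and> \<epsilon> \<le> \<bar>S k \<omega> - S m \<omega>\<bar>)"
    have K: "m \<le> K" "K \<le> n" "\<epsilon> \<le> \<bar>S K \<omega> - S m \<omega>\<bar>"
      using LeastI_ex[OF ex] unfolding K_def by auto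
    have min: "\<bar>S k \<omega> - S m \<omega>\<bar> < \<epsilon>" if "m \<le> k" "k < K" for k
      using not_less_Least[of k "\<lambda>k. m \<le> k \<and> k \<le> n \<and> \<epsilon> \<le> \<bar>S k \<omega> - S m \<omega>\<bar>"] that K(2)
      unfolding K_def by auto
    have "?R \<omega> = (\<Sum>i\<in>{m..<K}. below \<epsilon> m i \<omega> * \<xi> i \<omega>) + (\<Sum>i\<in>{K..<n}. below \<epsilon> m i \<omega> * \<xi> i \<omega>)"
      unfolding stopped_def using K by (simp add: sum.atLeastLessThan_concat)
    also have "(\<Sum>i\<in>{K..<n}. below \<epsilon> m i \<omega> * \<xi> i \<omega>) = 0"
    proof (intro sum.neutral ballI)
      fix i assume "i \<in> {K..<n}"
      then have "K \<in> {m..i}" using K by simp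
      then have "below \<epsilon> m i \<omega> = 0" using K(3) unfolding below_def by (meson leD)
      then show "below \<epsilon> m i \<omega> * \<xi> i \<omega> = 0" by simp
    qed
    also have "(\<Sum>i\<in>{m..<K}. below \<epsilon> m i \<omega> * \<xi> i \<omega>) = (\<Sum>i\<in>{m..<K}. \<xi> i \<omega>)"
      using min by (intro sum.cong) (auto simp: below_def)
    also have "\<dots> = S K \<omega> - S m \<omega>"
      using sum.atLeastLessThan_concat[of 0 m K "\<lambda>i. \<xi> i \<omega>"] K(1)
      by (simp add: S_def lessThan_atLeast0)
    finally have "\<bar>\<epsilon>\<bar> \<le> \<bar>?R \<omega>\<bar>" using K(3) assms by simp
    then show "\<epsilon>\<^sup>2 \<le> (?R \<omega>)\<^sup>2" by (simp only: abs_le_square_iff)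
  qed
  then have "prob {\<omega> \<in> space M. \<exists>k\<in>{m..n}. \<epsilon> \<le> \<bar>S k \<omega> - S m \<omega>\<bar>} \<le> prob {\<omega> \<in> space M. \<epsilon>\<^sup>2 \<le> (?R \<omega>)\<^sup>2}"
    by (intro finite_measure_mono) measurable
  also have "\<dots> \<le> (\<integral>\<omega>. (?R \<omega>)\<^sup>2 \<partial>M) / \<epsilon>\<^sup>2"
  proof (rule integral_Markov_inequality_measure[where A = "space M", simplified])
    obtain b where b: "AE \<omega> in M. \<bar>?R \<omega>\<bar> \<le> b" using stopped_bounded by blast
    show "integrable M (\<lambda>\<omega>. (?R \<omega>)\<^sup>2)"
      by (rule bounded_integrable[of _ "b\<^sup>2"], measurable, use b in eventually_elim)
        (metis abs_ge_zero abs_power2 power2_abs power_mono)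
  qed (use assms in auto)
  also have "\<dots> \<le> (\<Sum>i\<in>{m..<n}. \<integral>\<omega>. (\<xi> i \<omega>)\<^sup>2 \<partial>M) / \<epsilon>\<^sup>2"
    by (intro divide_right_mono stopped_second_moment) simp
  finally show ?thesis .
qed

text \<open>The exceptional event requires an exit after every time \<open>m\<close>. Its
  probability is at most a tail of the summable second moments over \<open>\<epsilon>^2\<close>, for
  every \<open>m\<close>, hence zero.\<close>

lemma AE_eventually_close:
  assumes "0 < \<epsilon>"
  shows "AE \<omega> in M. \<exists>m. \<forall>k\<ge>m. \<bar>S k \<omega> - S m \<omega>\<bar> < \<epsilon>"
proof -
  have [measurable]: "S k \<in> borel_measurable M" for k using M_measD S_meas by blast
  define f where "f i = (\<integral>\<omega>. (\<xi> i \<omega>)\<^sup>2 \<partial>M)" for i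
  have f0: "0 \<le> f i" for i by (simp add: f_def)
  have sm: "summable f"
    by (rule bounded_imp_summable[OF f0]) (use second_moments in \<open>simp only: f_def lessThan_Suc_atMost[symmetric]\<close>)
  define A where "A m n = {\<omega> \<in> space M. \<exists>k\<in>{m..n}. \<epsilon> \<le> \<bar>S k \<omega> - S m \<omega>\<bar>}" for m n
  have [measurable]: "A m n \<in> sets M" for m n unfolding A_def by measurable
  have bound: "prob (\<Union>n. A m n) \<le> (suminf f - sum f {..<m}) / \<epsilon>\<^sup>2" for m
  proof (rule LIMSEQ_le_const2)
    show "(\<lambda>n. prob (A m n)) \<longlonglongrightarrow> prob (\<Union>n. A m n)"
      by (intro finite_Lim_measure_incseq) (auto simp: incseq_def A_def)
    have "prob (A m n) \<le> (suminf f - sum f {..<m}) / \<epsilon>\<^sup>2" for n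
    proof -
      have "prob (A m n) \<le> sum f {m..<n} / \<epsilon>\<^sup>2"
        using maximal_inequality[OF assms] by (simp add: A_def f_def)
      also have "sum f {m..<n} \<le> suminf f - sum f {..<m}"
      proof (cases "m \<le> n")
        case True
        then have "sum f {..<m} + sum f {m..<n} = sum f {..<n}"
          by (simp add: lessThan_atLeast0 sum.atLeastLessThan_concat)
        moreover have "sum f {..<n} \<le> suminf f" using sm f0 by (intro sum_le_suminf) auto
        ultimately show ?thesis by linarith
      next
        case False
        then show ?thesis using sum_le_suminf[OF sm, of "{..<m}"] f0 by simp
      qed
      finally show ?thesis by (simp add: divide_right_mono)
    qed
    then show "\<exists>N. \<forall>n\<ge>N. prob (A m n) \<le> (suminf f - sum f {..<m}) / \<epsilon>\<^sup>2" by blast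
  qed
  have "prob (\<Inter>m. \<Union>n. A m n) \<le> 0"
  proof (rule LIMSEQ_le_const)
    have "(\<lambda>m. (suminf f - sum f {..<m}) / \<epsilon>\<^sup>2) \<longlonglongrightarrow> (suminf f - suminf f) / \<epsilon>\<^sup>2"
      using assms by (intro tendsto_intros summable_LIMSEQ sm) auto
    then show "(\<lambda>m. (suminf f - sum f {..<m}) / \<epsilon>\<^sup>2) \<longlonglongrightarrow> 0" by simp
    have "prob (\<Inter>m. \<Union>n. A m n) \<le> prob (\<Union>n. A m n)" for m
      by (intro finite_measure_mono) auto
    then show "\<exists>N. \<forall>m\<ge>N. prob (\<Inter>m. \<Union>n. A m n) \<le> (suminf f - sum f {..<m}) / \<epsilon>\<^sup>2"
      using bound order_trans by blast
  qed
  then have "(\<Inter>m. \<Union>n. A m n) \<in> null_sets M"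
    by (intro null_setsI) (auto simp: emeasure_eq_measure measure_le_0_iff)
  then have "AE \<omega> in M. \<omega> \<notin> (\<Inter>m. \<Union>n. A m n)" by (rule AE_not_in)
  then show ?thesis
  proof (rule AE_mp, intro AE_I2 impI)
    fix \<omega> assume "\<omega> \<in> space M" "\<omega> \<notin> (\<Inter>m. \<Union>n. A m n)"
    then obtain m where "\<And>n. \<omega> \<notin> A m n" by blast
    then have "\<bar>S k \<omega> - S m \<omega>\<bar> < \<epsilon>" if "m \<le> k" for k
      using \<open>\<omega> \<in> space M\<close> that unfolding A_def by (metis (lifting) atLeastAtMost_iff le_refl linorder_not_less mem_Collect_eq)
    then have "\<forall>k\<ge>m. \<bar>S k \<omega> - S m \<omega>\<bar> < \<epsilon>" by blast
    then show "\<exists>m. \<forall>k\<ge>m. \<bar>S k \<omega> - S m \<omega>\<bar> < \<epsilon>" by blast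
  qed
qed

text \<open>Taking tolerances \<open>1 / (r + 1)\<close> leaves countably many null sets, outside of
  which the partial sums are Cauchy.\<close>

lemma AE_convergent: "AE \<omega> in M. convergent (\<lambda>n. \<Sum>i<n. \<xi> i \<omega>)"
proof -
  have "AE \<omega> in M. \<forall>r. \<exists>m. \<forall>k\<ge>m. \<bar>S k \<omega> - S m \<omega>\<bar> < 1 / real (Suc r)"
    unfolding AE_all_countable by (intro allI AE_eventually_close) simp
  then show ?thesis
  proof eventually_elim
    case (elim \<omega>)
    have "Cauchy (\<lambda>n. S n \<omega>)"
    proof (rule metric_CauchyI)
      fix e :: real assume "0 < e"
      then obtain r where r: "1 / real (Suc r) < e / 2"
        using nat_approx_posE[of "e / 2"] by auto
      obtain m where m: "\<And>k. m \<le> k \<Longrightarrow> \<bar>S k \<omega> - S m \<omega>\<bar> < 1 / real (Suc r)" using elim by blast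
      have "dist (S k \<omega>) (S l \<omega>) < e" if "m \<le> k" "m \<le> l" for k l
        using m[OF that(1)] m[OF that(2)] r by (simp add: dist_real_def)
      then show "\<exists>N. \<forall>k\<ge>N. \<forall>l\<ge>N. dist (S k \<omega>) (S l \<omega>) < e" by blast
    qed
    then show ?case by (simp add: real_Cauchy_convergent S_def)
  qed
qed

end


section \<open>The random process\<close>

lemma set_pmf_signaling_step:
  "set_pmf (signaling_step v) \<subseteq> insert v (range (\<lambda>(k, l). bump v k l))"
proof
  fix w assume "w \<in> set_pmf (signaling_step v)"
  then obtain i j k where "w = (if k = i then bump v i j else v)"
    unfolding signaling_step_def bump_def[symmetric] by auto
  then show "w \<in> insert v (range (\<lambda>(k, l). bump v k l))" by (auto split: if_splits)
qed

lemma all_positive_sum_gt_0: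
  fixes v :: "'a::finite \<Rightarrow> 'b::finite \<Rightarrow> nat"
  assumes "all_positive v"
  shows "0 < (\<Sum>l\<in>UNIV. v i l)" "0 < (\<Sum>l\<in>UNIV. v l j)"
  using assms by (auto simp: all_positive_def Suc_le_eq intro!: sum_pos)

text \<open>A failed round leaves the counts alone, so only successes contribute. The factor
  \<open>1 / CARD('a)\<close> comes from the uniform state.\<close>

lemma expectation_signaling_step:
  fixes v :: "'a::finite \<Rightarrow> 'b::finite \<Rightarrow> nat" and g :: "('a \<Rightarrow> 'b \<Rightarrow> nat) \<Rightarrow> real"
  assumes "all_positive v"
  shows "measure_pmf.expectation (signaling_step v) g = g v + drift g v / real CARD('a)"
proof -
  note pos = all_positive_gt_0[OF assms]
  let ?s = "\<lambda>i j k. if k = i then bump v i j else v"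
  have "measure_pmf.expectation (signaling_step v) g = (\<Sum>i\<in>UNIV. 1 / real CARD('a) *
     (\<Sum>j\<in>UNIV. real (v i j) / row_sum v i * (\<Sum>k\<in>UNIV. real (v k j) / col_sum v j * g (?s i j k))))"
  proof -
    have "measure_pmf.expectation (proportional (\<lambda>l. v l j) \<bind> (\<lambda>k. return_pmf (?s i j k))) g
      = (\<Sum>k\<in>UNIV. real (v k j) / col_sum v j * g (?s i j k))" for i j
      by (subst pmf_expectation_bind[of UNIV])
        (simp_all add: pmf_proportional[OF all_positive_sum_gt_0(2)[OF assms]] col_sum_def)
    moreover have "measure_pmf.expectation (proportional (\<lambda>l. v i l) \<bind> f) g
      = (\<Sum>j\<in>UNIV. real (v i j) / row_sum v i * measure_pmf.expectation (f j) g)"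
      if "\<And>j. finite (set_pmf (f j))" for i and f :: "'b \<Rightarrow> ('a \<Rightarrow> 'b \<Rightarrow> nat) pmf"
      using that by (subst pmf_expectation_bind[of UNIV])
        (simp_all add: pmf_proportional[OF all_positive_sum_gt_0(1)[OF assms]] row_sum_def)
    ultimately show ?thesis
      unfolding signaling_step_def bump_def[symmetric]
      by (subst pmf_expectation_bind[of UNIV]) (simp_all add: divide_inverse mult.commute)
  qed
  also have "\<dots> = (\<Sum>i\<in>(UNIV :: 'a set). 1 / real CARD('a) *
     (\<Sum>j\<in>UNIV. real (v i j) / row_sum v i * (g v + real (v i j) / col_sum v j * (g (bump v i j) - g v))))"
  proof -
    \<comment> \<open>The act probabilities sum to 1, and only the act \<open>k = i\<close> changes
      the value of \<open>g\<close>.\<close>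
    have "(\<Sum>k\<in>UNIV. real (v k j) / col_sum v j * g (?s i j k))
      = g v + real (v i j) / col_sum v j * (g (bump v i j) - g v)" for i j
    proof -
      have "(\<Sum>k\<in>UNIV. real (v k j) / col_sum v j * g (?s i j k))
        = (\<Sum>k\<in>UNIV. real (v k j) / col_sum v j * g v
            + (if k = i then real (v i j) / col_sum v j * (g (bump v i j) - g v) else 0))"
        by (intro sum.cong) (auto simp: right_diff_distrib)
      also have "\<dots> = g v + real (v i j) / col_sum v j * (g (bump v i j) - g v)"
        using pos(2)[of j]
        by (simp add: sum.distrib sum_distrib_right[symmetric] sum_divide_distrib[symmetric] col_sum_def[symmetric])
      finally show ?thesis .
    qed
    then show ?thesis by simp
  qed
  also have "\<dots> = (\<Sum>i\<in>(UNIV :: 'a set). 1 / real CARD('a) *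
      (g v + (\<Sum>j\<in>UNIV. succ_prob v i j * (g (bump v i j) - g v))))"
  proof -
    have "(\<Sum>j\<in>UNIV. real (v i j) / row_sum v i * (g v + real (v i j) / col_sum v j * (g (bump v i j) - g v)))
      = g v + (\<Sum>j\<in>UNIV. succ_prob v i j * (g (bump v i j) - g v))" for i
    proof -
      have "(\<Sum>j\<in>UNIV. real (v i j) / row_sum v i * g v) = g v"
        using pos(1)[of i]
        by (simp add: sum_distrib_right[symmetric] sum_divide_distrib[symmetric] row_sum_def[symmetric])
      then show ?thesis
        by (simp add: distrib_left sum.distrib succ_prob_def power2_eq_square mult.assoc)
    qed
    then show ?thesis by simp
  qed
  also have "\<dots> = g v + drift g v / real CARD('a)"
    by (simp add: sum.distrib drift_def add_divide_distrib sum_divide_distrib)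
  finally show ?thesis .
qed

text \<open>Counts after \<open>n\<close> rounds are at most \<open>n + 1\<close>. Almost surely
  \<open>V n\<close> thus takes finitely many values, so any function of it is bounded and
  expectations become finite sums.\<close>

definition up_to :: "nat \<Rightarrow> ('a::finite \<Rightarrow> 'b::finite \<Rightarrow> nat) set" where
  "up_to n = {v. \<forall>i j. v i j \<le> n}"

lemma finite_up_to: "finite (up_to n :: ('a::finite \<Rightarrow> 'b::finite \<Rightarrow> nat) set)"
proof -
  have "up_to n = PiE (UNIV :: 'a set) (\<lambda>_. PiE (UNIV :: 'b set) (\<lambda>_. {..n}))"
    by (auto simp: up_to_def PiE_iff)
  then show ?thesis by (simp only:) (intro finite_PiE; simp)
qed

lemma bump_up_to: "v \<in> up_to n \<Longrightarrow> bump v k l \<in> up_to (Suc n)"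
  by (auto simp: up_to_def bump_def intro: le_SucI)

lemma up_to_Suc: "v \<in> up_to n \<Longrightarrow> v \<in> up_to (Suc n)"
  by (auto simp: up_to_def le_Suc_eq)

text \<open>Collects what is used about single paths; it holds almost surely, and the later limit
  arguments are deterministic consequences.\<close>

definition steps_ok :: "(nat \<Rightarrow> 'a::finite \<Rightarrow> 'b::finite \<Rightarrow> nat) \<Rightarrow> bool" where
  "steps_ok v \<longleftrightarrow> v 0 = (\<lambda>_ _. 1) \<and> (\<forall>n. v (Suc n) = v n \<or> (\<exists>k l. v (Suc n) = bump (v n) k l))"

lemma steps_ok_bounds:
  assumes "steps_ok v" shows "all_positive (v n)" "v n \<in> up_to (Suc n)"
proof (induction n)
  case 0
  show "all_positive (v 0)" "v 0 \<in> up_to (Suc 0)"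
    using assms by (auto simp: steps_ok_def all_positive_def up_to_def)
next
  case (Suc n)
  show "all_positive (v (Suc n))" "v (Suc n) \<in> up_to (Suc (Suc n))"
    using assms Suc all_positive_bump[OF Suc(1)] bump_up_to[OF Suc(2)] up_to_Suc[OF Suc(2)]
    unfolding steps_ok_def by metis+
qed

lemma (in prob_space) integrable_mult_bounded:
  fixes f g :: "'a \<Rightarrow> real"
  assumes "f \<in> borel_measurable M" "AE \<omega> in M. \<bar>f \<omega>\<bar> \<le> b"
    and "g \<in> borel_measurable M" "AE \<omega> in M. \<bar>g \<omega>\<bar> \<le> c"
  shows "integrable M (\<lambda>\<omega>. f \<omega> * g \<omega>)"
proof (rule integrable_const_bound[of _ "b * c"])
  show "AE \<omega> in M. norm (f \<omega> * g \<omega>) \<le> b * c"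
    using assms(2,4)
  proof eventually_elim
    case (elim \<omega>)
    then show ?case unfolding real_norm_def abs_mult by (intro mult_mono) auto
  qed
  show "(\<lambda>\<omega>. f \<omega> * g \<omega>) \<in> borel_measurable M"
    using assms(1,3) by (rule borel_measurable_times)
qed

lemma clock_nonneg: "all_positive v \<Longrightarrow> 0 \<le> clock v"
  using all_positive_gt_0[of v] by (simp add: clock_def sum_nonneg less_imp_le add_nonneg_nonneg)

section \<open>Conditional expectations along the process\<close>

context signaling_process
begin

lemma V_meas: "V n \<in> M \<rightarrow>\<^sub>M count_space UNIV"
  using measurable_from_subalg[OF subalg adapted] .

lemma g_V_meas_F: "(\<lambda>\<omega>. g (V n \<omega>)) \<in> borel_measurable (F n)" for g :: "_ \<Rightarrow> real"
  using measurable_compose[OF adapted, of g borel] by simp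

lemma g_V_meas [measurable]: "(\<lambda>\<omega>. g (V n \<omega>)) \<in> borel_measurable M" for g :: "_ \<Rightarrow> real"
  using measurable_compose[OF V_meas, of g borel] by simp

lemma subalgebra_F: "m \<le> n \<Longrightarrow> subalgebra (F n) (F m)"
  using sets_F_mono space_F by (auto simp: subalgebra_def)

lemma indicator_V_meas: "indicat_real {\<omega>' \<in> space M. V n \<omega>' = v} \<in> borel_measurable M"
proof -
  have "{\<omega>' \<in> space M. V n \<omega>' = v} = V n -` {v} \<inter> space M" by auto
  then show ?thesis
    using measurable_sets[OF V_meas[of n], of "{v}"] by (intro borel_measurable_indicator) simp
qed

lemma indicator_V_bounded: "AE \<omega> in M. \<bar>indicat_real {\<omega>' \<in> space M. V n \<omega>' = v} \<omega>\<bar> \<le> 1"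
  by (intro AE_I2) (simp add: indicator_def)

text \<open>The transition law tested against a bounded variable of the past, by the defining
  property of conditional expectation.\<close>

lemma conditional_step:
  assumes Z: "Z \<in> borel_measurable (F n)" "AE \<omega> in M. \<bar>Z \<omega>\<bar> \<le> b"
  shows "(\<integral>\<omega>. Z \<omega> * indicat_real {\<omega>' \<in> space M. V (Suc n) \<omega>' = v} \<omega> \<partial>M)
    = (\<integral>\<omega>. Z \<omega> * pmf (signaling_step (V n \<omega>)) v \<partial>M)"
proof -
  interpret finite_measure_subalgebra M "F n"
    using subalg by unfold_locales
  let ?g = "indicat_real {\<omega>' \<in> space M. V (Suc n) \<omega>' = v}"
  have ZM: "Z \<in> borel_measurable M"
    using measurable_from_subalg[OF subalg Z(1)] .
  have int: "integrable M (\<lambda>\<omega>. Z \<omega> * ?g \<omega>)"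
    by (rule integrable_mult_bounded[OF ZM Z(2) indicator_V_meas indicator_V_bounded])
  have "(\<integral>\<omega>. Z \<omega> * ?g \<omega> \<partial>M) = (\<integral>\<omega>. Z \<omega> * real_cond_exp M (F n) ?g \<omega> \<partial>M)"
    using real_cond_exp_intg(2)[OF int Z(1) indicator_V_meas] by simp
  also have "\<dots> = (\<integral>\<omega>. Z \<omega> * pmf (signaling_step (V n \<omega>)) v \<partial>M)"
  proof (rule integral_cong_AE)
    show "(\<lambda>\<omega>. Z \<omega> * real_cond_exp M (F n) ?g \<omega>) \<in> borel_measurable M"
      by (intro borel_measurable_times ZM borel_measurable_cond_exp2)
    show "(\<lambda>\<omega>. Z \<omega> * pmf (signaling_step (V n \<omega>)) v) \<in> borel_measurable M"
      by (intro borel_measurable_times ZM g_V_meas[of "\<lambda>u. pmf (signaling_step u) v"])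
    show "AE \<omega> in M. Z \<omega> * real_cond_exp M (F n) ?g \<omega> = Z \<omega> * pmf (signaling_step (V n \<omega>)) v"
      using transition[of n v] by eventually_elim simp
  qed
  finally show ?thesis .
qed

text \<open>Testing with the indicator of \<open>V n = v\<close> makes each impossible transition
  from \<open>v\<close> to \<open>w\<close> a null event, and there are only countably many pairs of
  count arrays.\<close>

lemma AE_step: "AE \<omega> in M. V (Suc n) \<omega> \<in> set_pmf (signaling_step (V n \<omega>))"
proof -
  have "AE \<omega> in M. \<not> (V n \<omega> = v \<and> V (Suc n) \<omega> = w)" if w: "pmf (signaling_step v) w = 0" for v w
  proof -
    define Z where "Z \<omega> = (if V n \<omega> = v then 1 else 0 :: real)" for \<omega>
    have Z: "Z \<in> borel_measurable (F n)" "AE \<omega> in M. \<bar>Z \<omega>\<bar> \<le> 1"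
      unfolding Z_def by (rule g_V_meas_F, intro AE_I2, simp)
    have ZM: "Z \<in> borel_measurable M"
      using measurable_from_subalg[OF subalg Z(1)] .
    let ?g = "\<lambda>\<omega>. Z \<omega> * indicat_real {\<omega>' \<in> space M. V (Suc n) \<omega>' = w} \<omega>"
    have "(\<integral>\<omega>. ?g \<omega> \<partial>M) = (\<integral>\<omega>. Z \<omega> * pmf (signaling_step (V n \<omega>)) w \<partial>M)"
      by (rule conditional_step[OF Z])
    also have "\<dots> = (\<integral>\<omega>. 0 \<partial>M)"
      using w by (intro Bochner_Integration.integral_cong refl) (simp add: Z_def)
    finally have zero: "(\<integral>\<omega>. ?g \<omega> \<partial>M) = 0" by simp
    have int: "integrable M ?g"
      by (rule integrable_mult_bounded[OF ZM Z(2) indicator_V_meas indicator_V_bounded])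
    have "AE \<omega> in M. 0 \<le> ?g \<omega>"
      by (intro AE_I2) (simp add: Z_def)
    from integral_nonneg_eq_0_iff_AE[OF int this] zero
    have "AE \<omega> in M. ?g \<omega> = 0" by simp
    then show ?thesis
      using AE_space by eventually_elim (auto simp: Z_def indicator_def)
  qed
  then have "\<forall>v w. AE \<omega> in M. pmf (signaling_step v) w = 0 \<longrightarrow> \<not> (V n \<omega> = v \<and> V (Suc n) \<omega> = w)"
    using AE_impI by blast
  then have "AE \<omega> in M. \<forall>v w. pmf (signaling_step v) w = 0 \<longrightarrow> \<not> (V n \<omega> = v \<and> V (Suc n) \<omega> = w)"
    by (simp only: AE_all_countable simp_thms)
  then show ?thesis
  proof eventually_elim
    case (elim \<omega>)
    then show ?case unfolding set_pmf_iff by blast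
  qed
qed

lemma AE_steps_ok: "AE \<omega> in M. steps_ok (\<lambda>n. V n \<omega>)"
proof -
  have "AE \<omega> in M. \<forall>n. V (Suc n) \<omega> \<in> set_pmf (signaling_step (V n \<omega>))"
    using AE_step by (simp add: AE_all_countable)
  moreover have "AE \<omega> in M. V 0 \<omega> = (\<lambda>_ _. 1)"
    using start by (intro AE_I2) (auto simp: fun_eq_iff)
  ultimately show ?thesis
  proof eventually_elim
    case (elim \<omega>)
    have "V (Suc n) \<omega> = V n \<omega> \<or> (\<exists>k l. V (Suc n) \<omega> = bump (V n \<omega>) k l)" for n
      using subsetD[OF set_pmf_signaling_step elim(1)[rule_format, of n]] by auto
    then show ?case using elim(2) by (simp add: steps_ok_def)
  qed
qed

lemma g_V_bounded: "AE \<omega> in M. \<bar>g (V n \<omega>)\<bar> \<le> (\<Sum>v\<in>up_to (Suc n). \<bar>g v\<bar>)" for g :: "_ \<Rightarrow> real"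
  using AE_steps_ok
proof eventually_elim
  case (elim \<omega>)
  show ?case
    using steps_ok_bounds(2)[OF elim, of n] by (intro member_le_sum[where f = "\<lambda>v. \<bar>g v\<bar>"] finite_up_to) auto
qed

lemma g_V_integrable: "integrable M (\<lambda>\<omega>. g (V n \<omega>))" for g :: "_ \<Rightarrow> real"
  using g_V_bounded[of g n] by (intro integrable_const_bound[of _ "\<Sum>v\<in>up_to (Suc n). \<bar>g v\<bar>"]) auto

text \<open>Expand \<open>g\<close> over the finitely many possible values of the next state and
  apply \<open>conditional_step\<close> to each of them.\<close>

lemma conditional_expectation:
  fixes g :: "('a \<Rightarrow> 'b \<Rightarrow> nat) \<Rightarrow> real"
  assumes Z: "Z \<in> borel_measurable (F n)" "AE \<omega> in M. \<bar>Z \<omega>\<bar> \<le> b"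
  shows "(\<integral>\<omega>. Z \<omega> * g (V (Suc n) \<omega>) \<partial>M)
    = (\<integral>\<omega>. Z \<omega> * (g (V n \<omega>) + drift g (V n \<omega>) / real CARD('a)) \<partial>M)"
proof -
  have ZM [measurable]: "Z \<in> borel_measurable M"
    using measurable_from_subalg[OF subalg Z(1)] .
  let ?W = "up_to (Suc (Suc n)) :: ('a \<Rightarrow> 'b \<Rightarrow> nat) set"
  let ?I = "\<lambda>v. indicat_real {\<omega>' \<in> space M. V (Suc n) \<omega>' = v}"
  let ?P = "\<lambda>v \<omega>. pmf (signaling_step (V n \<omega>)) v"
  have P_meas: "?P v \<in> borel_measurable M" for v by (rule g_V_meas)
  have int1: "integrable M (\<lambda>\<omega>. g v * (Z \<omega> * ?I v \<omega>))" for v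
    by (intro integrable_mult_right integrable_mult_bounded[OF ZM Z(2) indicator_V_meas indicator_V_bounded])
  have int2: "integrable M (\<lambda>\<omega>. g v * (Z \<omega> * ?P v \<omega>))" for v
    by (intro integrable_mult_right integrable_mult_bounded[OF ZM Z(2) P_meas, of _ 1] AE_I2) (simp add: pmf_le_1)
  have "(\<integral>\<omega>. Z \<omega> * g (V (Suc n) \<omega>) \<partial>M) = (\<integral>\<omega>. (\<Sum>v\<in>?W. g v * (Z \<omega> * ?I v \<omega>)) \<partial>M)"
  proof (rule integral_cong_AE)
    show "AE \<omega> in M. Z \<omega> * g (V (Suc n) \<omega>) = (\<Sum>v\<in>?W. g v * (Z \<omega> * ?I v \<omega>))"
      using AE_steps_ok AE_space
    proof eventually_elim
      case (elim \<omega>)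
      have "(\<Sum>v\<in>?W. g v * (Z \<omega> * ?I v \<omega>)) = (\<Sum>v\<in>?W. if v = V (Suc n) \<omega> then Z \<omega> * g v else 0)"
        using elim(2) by (intro sum.cong) (auto simp: indicator_def)
      also have "\<dots> = Z \<omega> * g (V (Suc n) \<omega>)"
        using steps_ok_bounds(2)[OF elim(1), of "Suc n"] by (simp add: finite_up_to)
      finally show ?case ..
    qed
  qed (intro borel_measurable_sum borel_measurable_times borel_measurable_const ZM indicator_V_meas g_V_meas)+
  also have "\<dots> = (\<Sum>v\<in>?W. g v * (\<integral>\<omega>. Z \<omega> * ?I v \<omega> \<partial>M))"
    by (subst Bochner_Integration.integral_sum[OF int1]) simp
  also have "\<dots> = (\<Sum>v\<in>?W. g v * (\<integral>\<omega>. Z \<omega> * pmf (signaling_step (V n \<omega>)) v \<partial>M))"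
    by (simp only: conditional_step[OF Z])
  also have "\<dots> = (\<integral>\<omega>. (\<Sum>v\<in>?W. g v * (Z \<omega> * pmf (signaling_step (V n \<omega>)) v)) \<partial>M)"
    by (subst Bochner_Integration.integral_sum[OF int2]) simp
  also have "\<dots> = (\<integral>\<omega>. Z \<omega> * (g (V n \<omega>) + drift g (V n \<omega>) / real CARD('a)) \<partial>M)"
  proof (rule integral_cong_AE)
    show "AE \<omega> in M. (\<Sum>v\<in>?W. g v * (Z \<omega> * pmf (signaling_step (V n \<omega>)) v))
        = Z \<omega> * (g (V n \<omega>) + drift g (V n \<omega>) / real CARD('a))"
      using AE_steps_ok
    proof eventually_elim
      case (elim \<omega>)
      note b = steps_ok_bounds[OF elim, of n]
      have "set_pmf (signaling_step (V n \<omega>)) \<subseteq> ?W"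
        using set_pmf_signaling_step[of "V n \<omega>"] up_to_Suc[OF b(2)] bump_up_to[OF b(2)] by auto
      then have "measure_pmf.expectation (signaling_step (V n \<omega>)) g
          = (\<Sum>v\<in>?W. g v * pmf (signaling_step (V n \<omega>)) v)"
        by (intro integral_measure_pmf_real finite_up_to) auto
      then show ?case
        unfolding expectation_signaling_step[OF b(1), symmetric]
        by (simp add: sum_distrib_left mult_ac)
    qed
  qed (intro borel_measurable_sum borel_measurable_times borel_measurable_const ZM P_meas
      g_V_meas[of "\<lambda>v. g v + drift g v / real CARD('a)"])+
  finally show ?thesis .
qed

text \<open>Subtracting the accumulated drift leaves a martingale. Its second moments are bounded by
  multiples of the expected clock decreases, which telescope to at most the initial value.\<close>

lemma AE_convergent_compensated:
  fixes g :: "('a \<Rightarrow> 'b \<Rightarrow> nat) \<Rightarrow> real"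
  assumes "tame g"
  shows "AE \<omega> in M. convergent (\<lambda>n. g (V n \<omega>) - (\<Sum>m<n. drift g (V m \<omega>) / real CARD('a)))"
proof -
  obtain c where c: "0 \<le> c"
    "\<And>v k l. all_positive v \<Longrightarrow> \<bar>g (bump v k l) - g v\<bar> \<le> c * (1 / row_sum v k + 1 / col_sum v l)"
    using assms unfolding tame_def by metis
  define d where "d v = drift g v / real CARD('a)" for v
  define \<xi> where "\<xi> n \<omega> = g (V (Suc n) \<omega>) - (g (V n \<omega>) + d (V n \<omega>))" for n \<omega>
  have \<xi>_meas [measurable]: "\<xi> n \<in> borel_measurable M" for n
    unfolding \<xi>_def[abs_def] by (intro borel_measurable_diff borel_measurable_add g_V_meas)
  have orth: "(\<integral>\<omega>. Z \<omega> * \<xi> n \<omega> \<partial>M) = 0"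
    if Z: "Z \<in> borel_measurable (F n)" "AE \<omega> in M. \<bar>Z \<omega>\<bar> \<le> b" for Z n b
  proof -
    have ZM [measurable]: "Z \<in> borel_measurable M"
      using measurable_from_subalg[OF subalg Z(1)] .
    have int: "integrable M (\<lambda>\<omega>. Z \<omega> * f (V m \<omega>))" for f :: "_ \<Rightarrow> real" and m
      by (rule integrable_mult_bounded[OF ZM Z(2) g_V_meas g_V_bounded])
    have "(\<integral>\<omega>. Z \<omega> * \<xi> n \<omega> \<partial>M) = (\<integral>\<omega>. Z \<omega> * g (V (Suc n) \<omega>) \<partial>M) - (\<integral>\<omega>. Z \<omega> * (g (V n \<omega>) + d (V n \<omega>)) \<partial>M)"
      unfolding \<xi>_def right_diff_distrib
      using int[of "\<lambda>v. g v + d v" n] int[of g "Suc n"] by (rule Bochner_Integration.integral_diff[rotated])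
    then show ?thesis using conditional_expectation[OF Z, of g] by (simp add: d_def)
  qed
  have \<xi>_bounded: "\<exists>b. AE \<omega> in M. \<bar>\<xi> n \<omega>\<bar> \<le> b" for n
  proof -
    have "AE \<omega> in M. \<bar>\<xi> n \<omega>\<bar> \<le> (\<Sum>v\<in>up_to (Suc (Suc n)). \<bar>g v\<bar>) + (\<Sum>v\<in>up_to (Suc n). \<bar>g v + d v\<bar>)"
      using g_V_bounded[of g "Suc n"] g_V_bounded[of "\<lambda>v. g v + d v" n]
      unfolding \<xi>_def by eventually_elim linarith
    then show ?thesis by blast
  qed
  have second: "(\<integral>\<omega>. (\<xi> n \<omega>)\<^sup>2 \<partial>M) \<le> 4 * c\<^sup>2 * ((\<integral>\<omega>. clock (V n \<omega>) \<partial>M) - (\<integral>\<omega>. clock (V (Suc n) \<omega>) \<partial>M))" for n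
  proof -
    have dm: "(\<lambda>\<omega>. d (V n \<omega>)) \<in> borel_measurable (F n)" by (rule g_V_meas_F)
    obtain b where b: "AE \<omega> in M. \<bar>\<xi> n \<omega>\<bar> \<le> b" using \<xi>_bounded by blast
    define e where "e = (\<Sum>v\<in>up_to (Suc n). \<bar>d v\<bar>)"
    have db: "AE \<omega> in M. \<bar>d (V n \<omega>)\<bar> \<le> e"
      unfolding e_def by (rule g_V_bounded)
    have int1: "integrable M (\<lambda>\<omega>. (\<xi> n \<omega>)\<^sup>2)"
      unfolding power2_eq_square by (rule integrable_mult_bounded[OF \<xi>_meas b \<xi>_meas b])
    have int2: "integrable M (\<lambda>\<omega>. d (V n \<omega>) * \<xi> n \<omega>)"
      by (rule integrable_mult_bounded[OF g_V_meas db \<xi>_meas b])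
    \<comment> \<open>Adding the vanishing cross term and completing the square gives
      \<open>\<xi>^2 + 2 * d * \<xi> + d^2 = (g (V (Suc n)) - g (V n))^2\<close>, so the increment
      of \<open>g\<close> alone has to be bounded.\<close>
    have "(\<integral>\<omega>. (\<xi> n \<omega>)\<^sup>2 \<partial>M) = (\<integral>\<omega>. (\<xi> n \<omega>)\<^sup>2 \<partial>M) + 2 * (\<integral>\<omega>. d (V n \<omega>) * \<xi> n \<omega> \<partial>M)"
      using orth[OF dm db] by simp
    also have "\<dots> = (\<integral>\<omega>. (\<xi> n \<omega>)\<^sup>2 + 2 * (d (V n \<omega>) * \<xi> n \<omega>) \<partial>M)"
      using int1 int2 by simp
    also have "\<dots> \<le> (\<integral>\<omega>. 4 * c\<^sup>2 * (clock (V n \<omega>) - clock (V (Suc n) \<omega>)) \<partial>M)"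
    proof (rule integral_mono_AE)
      show "integrable M (\<lambda>\<omega>. (\<xi> n \<omega>)\<^sup>2 + 2 * (d (V n \<omega>) * \<xi> n \<omega>))" using int1 int2 by simp
      show "integrable M (\<lambda>\<omega>. 4 * c\<^sup>2 * (clock (V n \<omega>) - clock (V (Suc n) \<omega>)))"
        using g_V_integrable by simp
      show "AE \<omega> in M. (\<xi> n \<omega>)\<^sup>2 + 2 * (d (V n \<omega>) * \<xi> n \<omega>) \<le> 4 * c\<^sup>2 * (clock (V n \<omega>) - clock (V (Suc n) \<omega>))"
        using AE_steps_ok
      proof eventually_elim
        case (elim \<omega>)
        note p = steps_ok_bounds(1)[OF elim, of n]
        have "(\<xi> n \<omega>)\<^sup>2 + 2 * (d (V n \<omega>) * \<xi> n \<omega>) + (d (V n \<omega>))\<^sup>2 = (g (V (Suc n) \<omega>) - g (V n \<omega>))\<^sup>2"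
          by (simp add: \<xi>_def power2_eq_square algebra_simps)
        moreover have "(g (V (Suc n) \<omega>) - g (V n \<omega>))\<^sup>2 \<le> 4 * c\<^sup>2 * (clock (V n \<omega>) - clock (V (Suc n) \<omega>))"
        proof (cases "V (Suc n) \<omega> = V n \<omega>")
          case False
          then obtain k l where kl: "V (Suc n) \<omega> = bump (V n \<omega>) k l"
            using elim unfolding steps_ok_def by blast
          have "(g (V (Suc n) \<omega>) - g (V n \<omega>))\<^sup>2 \<le> (c * (1 / row_sum (V n \<omega>) k + 1 / col_sum (V n \<omega>) l))\<^sup>2"
            using power_mono[OF c(2)[OF p, of k l] abs_ge_zero, of 2] by (simp add: kl)
          also have "\<dots> = c\<^sup>2 * (1 / row_sum (V n \<omega>) k + 1 / col_sum (V n \<omega>) l)\<^sup>2"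
            by (rule power_mult_distrib)
          also have "\<dots> \<le> c\<^sup>2 * (4 * (clock (V n \<omega>) - clock (V (Suc n) \<omega>)))"
            unfolding kl by (intro mult_left_mono clock_drop_ge(2) p) auto
          finally show ?thesis by (simp only: mult_ac)
        qed simp
        ultimately show ?case using zero_le_power2[of "d (V n \<omega>)"] by linarith
      qed
    qed
    also have "\<dots> = 4 * c\<^sup>2 * ((\<integral>\<omega>. clock (V n \<omega>) \<partial>M) - (\<integral>\<omega>. clock (V (Suc n) \<omega>) \<partial>M))"
      using g_V_integrable by simp
    finally show ?thesis .
  qed
  interpret l2_martingale M F \<xi> "4 * c\<^sup>2 * (\<integral>\<omega>. clock (V 0 \<omega>) \<partial>M)"
  proof unfold_locales
    show "\<xi> n \<in> borel_measurable (F (Suc n))" for n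
      unfolding \<xi>_def[abs_def]
      by (intro borel_measurable_diff g_V_meas_F
          measurable_from_subalg[OF subalgebra_F[of n "Suc n"] g_V_meas_F[of "\<lambda>v. g v + d v" n]]) simp
    show "(\<Sum>n<N. \<integral>\<omega>. (\<xi> n \<omega>)\<^sup>2 \<partial>M) \<le> 4 * c\<^sup>2 * (\<integral>\<omega>. clock (V 0 \<omega>) \<partial>M)" for N
    proof -
      have "(\<Sum>n<N. \<integral>\<omega>. (\<xi> n \<omega>)\<^sup>2 \<partial>M) \<le> 4 * c\<^sup>2 * ((\<integral>\<omega>. clock (V 0 \<omega>) \<partial>M) - (\<integral>\<omega>. clock (V N \<omega>) \<partial>M))"
        using sum_mono[where K = "{..<N}" and f = "\<lambda>n. \<integral>\<omega>. (\<xi> n \<omega>)\<^sup>2 \<partial>M", OF second]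
        by (simp add: sum_distrib_left[symmetric] sum_lessThan_telescope'[of "\<lambda>n. \<integral>\<omega>. clock (V n \<omega>) \<partial>M"])
      moreover have "0 \<le> (\<integral>\<omega>. clock (V N \<omega>) \<partial>M)"
        using AE_steps_ok by (intro integral_nonneg_AE, eventually_elim) (intro clock_nonneg steps_ok_bounds)
      then have "0 \<le> 4 * c\<^sup>2 * (\<integral>\<omega>. clock (V N \<omega>) \<partial>M)" by simp
      ultimately show ?thesis by (simp add: right_diff_distrib)
    qed
  qed (use subalg subalgebra_F \<xi>_bounded orth in auto)
  have sum_\<xi>: "(\<Sum>i<n. \<xi> i \<omega>) = g (V n \<omega>) - g (V 0 \<omega>) - (\<Sum>m<n. d (V m \<omega>))" for n \<omega>
    by (induction n) (auto simp: \<xi>_def)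
  show ?thesis
    using AE_convergent
  proof eventually_elim
    case (elim \<omega>)
    then have "convergent (\<lambda>n. g (V 0 \<omega>) + (\<Sum>i<n. \<xi> i \<omega>))"
      by (intro convergent_add convergent_const)
    then show ?case by (simp add: sum_\<xi> d_def)
  qed
qed

end


section \<open>Convergence to the equilibria\<close>

text \<open>A pathwise submartingale argument: an upper bound on \<open>a\<close> bounds the partial
  sums of the nonnegative drift, so they converge, and with them \<open>a\<close>.\<close>

lemma convergent_drift_sum:
  fixes a d :: "nat \<Rightarrow> real"
  assumes conv: "convergent (\<lambda>n. a n - (\<Sum>m<n. d m))"
    and d: "\<And>n. 0 \<le> d n" and a: "\<And>n. a n \<le> b"
  shows "summable d" "convergent a"
proof -
  from conv have "Bseq (\<lambda>n. a n - (\<Sum>m<n. d m))" by (rule convergent_imp_Bseq)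
  then obtain K where K: "\<And>n. \<bar>a n - (\<Sum>m<n. d m)\<bar> \<le> K" by (auto simp: Bseq_def)
  have "(\<Sum>m\<le>n. d m) \<le> b + K" for n
    using a[of "Suc n"] K[of "Suc n"] unfolding lessThan_Suc_atMost by linarith
  then show sm: "summable d" by (rule bounded_imp_summable[OF d])
  have "convergent (\<lambda>n. (a n - (\<Sum>m<n. d m)) + (\<Sum>m<n. d m))"
    using sm by (intro convergent_add conv) (simp add: summable_iff_convergent)
  then show "convergent a" by simp
qed

lemma not_summable_inverse_shifted:
  fixes c e :: real
  assumes "0 < e" "0 < c" shows "\<not> summable (\<lambda>n. e / (real n + c))"
proof
  assume sm: "summable (\<lambda>n. e / (real n + c))"
  have "summable (\<lambda>n. inverse (real n))"
  proof (rule summable_comparison_test_ev)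
    show "summable (\<lambda>n. (1 + c) / e * (e / (real n + c)))"
      using sm by (rule summable_mult)
    show "\<forall>\<^sub>F n in sequentially. norm (inverse (real n)) \<le> (1 + c) / e * (e / (real n + c))"
      using eventually_gt_at_top[of 0]
    proof eventually_elim
      case (elim n)
      have "c * 1 \<le> c * real n" using elim assms by (intro mult_left_mono) auto
      then have "real n + c \<le> (1 + c) * real n" by (simp add: algebra_simps)
      then have "inverse (real n) \<le> (1 + c) / (real n + c)"
        using elim assms by (simp add: field_simps)
      then show ?case using assms by simp
    qed
  qed
  then show False using not_summable_harmonic by blast
qed

lemma potential_le_cells:
  assumes "all_positive (v :: 'a::finite \<Rightarrow> 'b::finite \<Rightarrow> nat)" shows "potential v \<le> cells v"
proof -
  have "potential v \<le> (\<Sum>i\<in>(UNIV :: 'a set). \<Sum>j\<in>(UNIV :: 'b set). 1)"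
    unfolding potential_def by (intro sum_mono succ_prob_le_1 assms)
  then show ?thesis by simp
qed

text \<open>Applying \<open>convergent_drift_sum\<close> to \<open>adjusted_potential\<close> and
  then to \<open>- lyapunov\<close> makes \<open>potential\<close> and \<open>convex_sum\<close>
  converge, hence also the gap. The second application also makes the gap over the total summable,
  which leaves only the limit 0.\<close>

lemma gap_tendsto_0:
  fixes v :: "nat \<Rightarrow> 'a::finite \<Rightarrow> 'b::finite \<Rightarrow> nat"
  assumes v: "steps_ok v"
    and conv1: "convergent (\<lambda>n. adjusted_potential (v n) - (\<Sum>m<n. drift adjusted_potential (v m) / real CARD('a)))"
    and conv2: "convergent (\<lambda>n. lyapunov (v n) - (\<Sum>m<n. drift lyapunov (v m) / real CARD('a)))"
  shows "(\<lambda>n. gap (v n)) \<longlonglongrightarrow> 0" "convergent (\<lambda>n. potential (v n))"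
proof -
  define N where "N = cells (v 0)"
  note pos = steps_ok_bounds(1)[OF v]
  have clock: "convergent (\<lambda>n. clock (v n))"
  proof -
    have "clock (v (Suc n)) \<le> clock (v n)" for n
    proof (cases "v (Suc n) = v n")
      case False
      then obtain k l where kl: "v (Suc n) = bump (v n) k l" using v unfolding steps_ok_def by blast
      have "0 \<le> 1 / (row_sum (v n) k * col_sum (v n) l)"
        using all_positive_gt_0(1)[OF pos, of n k] all_positive_gt_0(2)[OF pos, of n l] by simp
      from order_trans[OF this clock_drop_ge(1)[OF pos]] show ?thesis by (simp add: kl)
    qed simp
    then have "decseq (\<lambda>n. clock (v n))" by (rule decseq_SucI)
    then obtain L where "(\<lambda>n. clock (v n)) \<longlonglongrightarrow> L"
      by (rule decseq_convergent[of _ 0]) (use clock_nonneg[OF pos] in auto)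
    then show ?thesis by (rule convergentI)
  qed
  have "adjusted_potential (v n) \<le> N" for n
    using potential_le_cells[OF pos, of n] clock_nonneg[OF pos, of n]
    by (simp add: adjusted_potential_def N_def)
  then have "convergent (\<lambda>n. adjusted_potential (v n))"
    using drift_adjusted_potential_nonneg[OF pos] by (intro convergent_drift_sum(2)[OF conv1]) auto
  then have "convergent (\<lambda>n. adjusted_potential (v n) + 4 * clock (v n))"
    using clock by (intro convergent_add) (simp_all add: convergent_mult_const_iff)
  then show pot: "convergent (\<lambda>n. potential (v n))"
    by (simp add: adjusted_potential_def)
  have gap0: "0 \<le> gap (v n)" for n using gap_nonneg[OF pos] .
  define d where "d n = - (drift lyapunov (v n) / real CARD('a))" for n
  have tot1: "0 < tot (v n) + 1" for n using all_positive_gt_0(3)[OF pos, of n] by simp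
  have d_ge: "gap (v n) / (real CARD('a) * (tot (v n) + 1)) \<le> d n" for n
    using drift_lyapunov_le[OF pos, of n] divide_right_mono[OF drift_lyapunov_le[OF pos, of n], of "real CARD('a)"]
    by (simp add: d_def mult.commute)
  then have d0: "0 \<le> d n" for n
    using gap0[of n] tot1[of n] by (meson divide_nonneg_pos mult_pos_pos of_nat_0_less_iff order_trans zero_less_card_finite)
  have conv2': "convergent (\<lambda>n. - lyapunov (v n) - (\<Sum>m<n. d m))"
    using convergent_minus_iff[THEN iffD1, OF conv2] by (simp add: d_def sum_negf)
  have "- lyapunov (v n) \<le> N" for n
  proof -
    have "0 \<le> convex_sum (v n)"
    proof -
      have "0 \<le> 1 / (1 + potential (v n))" using potential_nonneg[of "v n"] by simp
      then show ?thesis using gap0[of n] unfolding gap_def by linarith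
    qed
    moreover have "0 \<le> (36 * N + 8) * clock (v n)"
      using clock_nonneg[OF pos] by (intro mult_nonneg_nonneg) (auto simp: N_def)
    ultimately show ?thesis
      using potential_le_cells[OF pos, of n] by (simp add: lyapunov_def N_def)
  qed
  note lyap = convergent_drift_sum[OF conv2' d0 this]
  have "convergent (\<lambda>n. - (- lyapunov (v n)))"
    using lyap(2) by (rule convergent_minus_iff[THEN iffD1])
  then have "convergent (\<lambda>n. - (- lyapunov (v n)) + potential (v n) + (- (36 * N + 8)) * clock (v n))"
    by (intro convergent_add pot convergent_mult convergent_const clock)
  then have "convergent (\<lambda>n. convex_sum (v n))"
    by (simp add: lyapunov_def N_def algebra_simps)
  then obtain q where q: "(\<lambda>n. convex_sum (v n)) \<longlonglongrightarrow> q" by (auto simp: convergent_def)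
  obtain h where h: "(\<lambda>n. potential (v n)) \<longlonglongrightarrow> h" using pot by (auto simp: convergent_def)
  have "0 \<le> h" by (rule LIMSEQ_le_const[OF h]) (auto intro: potential_nonneg)
  then have "(\<lambda>n. gap (v n)) \<longlonglongrightarrow> q - 1 / (1 + h)"
    unfolding gap_def by (intro tendsto_intros q h) auto
  then obtain g where g: "(\<lambda>n. gap (v n)) \<longlonglongrightarrow> g" by blast
  have "0 \<le> g" by (rule LIMSEQ_le_const[OF g]) (auto intro: gap0)
  moreover have "\<not> 0 < g"
  proof
    assume "0 < g"
    \<comment> \<open>At most one count grows per round, so the total is at most linear. A positive
      limit of the gap would then bound a summable series below by a harmonic one.\<close>
    have tot_le: "tot (v n) \<le> real n + tot (v 0)" for n
    proof (induction n)
      case (Suc n)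
      have "tot (v (Suc n)) \<le> tot (v n) + 1"
        using v tot_bump[of "v n"] unfolding steps_ok_def by (metis add_increasing2 order_refl zero_le_one)
      then show ?case using Suc by simp
    qed simp
    define A where "A = real CARD('a)"
    have A: "0 < A" by (simp add: A_def)
    have "summable (\<lambda>n. (g / 2 / A) / (real n + (tot (v 0) + 1)))"
    proof (rule summable_comparison_test_ev[OF _ lyap(1)])
      have "\<forall>\<^sub>F n in sequentially. g / 2 < gap (v n)"
        using order_tendstoD(1)[OF g, of "g / 2"] \<open>0 < g\<close> by simp
      then show "\<forall>\<^sub>F n in sequentially. norm ((g / 2 / A) / (real n + (tot (v 0) + 1))) \<le> d n"
      proof eventually_elim
        case (elim n)
        have "(g / 2) / (A * (real n + (tot (v 0) + 1))) \<le> gap (v n) / (A * (tot (v n) + 1))"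
          using elim gap0 tot1[of n] tot_le[of n] A by (intro frac_le mult_left_mono mult_pos_pos) auto
        then show ?case
          using d_ge[of n] A \<open>0 < g\<close> tot1[of 0] by (simp add: A_def)
      qed
    qed
    then show False
      using not_summable_inverse_shifted[of "g / 2 / A" "tot (v 0) + 1"] \<open>0 < g\<close> A tot1[of 0] by auto
  qed
  ultimately have "g = 0" by simp
  then show "(\<lambda>n. gap (v n)) \<longlonglongrightarrow> 0" using g by simp
qed

section \<open>From a vanishing gap to the distance from the equilibria\<close>

text \<open>The squared quantity is \<open>x * (y - h)\<close>, a component of the mean field. Its
  square is one nonnegative summand of the gap times a bounded factor.\<close>

lemma defect_bound:
  fixes v :: "'a::finite \<Rightarrow> 'b::finite \<Rightarrow> nat"
  assumes "all_positive v"
  shows "(succ_prob v i j - potential v * share v i j)\<^sup>2 \<le> 2 * (1 + cells v)\<^sup>2 * gap v"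
proof -
  define x y h where "x = share v i j" and "y = tot v * ratio v i j" and "h = potential v"
  have x: "0 < x" "x \<le> 1" and y: "0 \<le> y" and h: "0 \<le> h" "h \<le> cells v"
    using share_pos[OF assms] share_le_1[OF assms] tot_ratio_nonneg potential_nonneg potential_le_cells[OF assms]
    by (auto simp: x_def y_def h_def)
  have p: "succ_prob v i j = x * y" using weight_eq(2)[OF assms] by (simp add: x_def y_def)
  let ?t = "\<lambda>i j. share v i j * (tot v * ratio v i j - potential v)\<^sup>2
    / ((1 + tot v * ratio v i j) * (1 + potential v)\<^sup>2)"
  have t0: "0 \<le> ?t i j" for i j
    using share_pos[OF assms, of i j] tot_ratio_nonneg[of v i j] by (simp add: less_imp_le)
  have "?t i j \<le> (\<Sum>j\<in>UNIV. ?t i j)"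
    by (rule member_le_sum[where f = "?t i"]) (use t0 in auto)
  also have "\<dots> \<le> (\<Sum>i\<in>UNIV. \<Sum>j\<in>UNIV. ?t i j)"
    by (rule member_le_sum[where f = "\<lambda>i. \<Sum>j\<in>UNIV. ?t i j"]) (simp, intro sum_nonneg t0, simp)
  finally have le: "x * (y - h)\<^sup>2 / ((1 + y) * (1 + h)\<^sup>2) \<le> gap v"
    unfolding gap_eq[OF assms] by (simp add: x_def y_def h_def)
  have sq: "(x * y - h * x)\<^sup>2 = (x + x * y) * (1 + h)\<^sup>2 * (x * (y - h)\<^sup>2 / ((1 + y) * (1 + h)\<^sup>2))"
  proof -
    have "(x + x * y) * (1 + h)\<^sup>2 = x * ((1 + y) * (1 + h)\<^sup>2)" by (simp add: algebra_simps)
    moreover have "(1 + y) * (1 + h)\<^sup>2 \<noteq> 0" using y h by auto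
    ultimately have "(x + x * y) * (1 + h)\<^sup>2 * (x * (y - h)\<^sup>2 / ((1 + y) * (1 + h)\<^sup>2)) = x * (x * (y - h)\<^sup>2)"
      by simp
    then show ?thesis by (simp add: power2_eq_square algebra_simps)
  qed
  \<comment> \<open>Here \<open>x + x * y\<close> is the share plus the success probability, each at
    most 1, and \<open>h\<close> is at most the number of cells.\<close>
  have le': "(x + x * y) * (1 + h)\<^sup>2 \<le> 2 * (1 + cells v)\<^sup>2"
    using x y h succ_prob_le_1[OF assms, of i j] p
    by (intro mult_mono power_mono) auto
  have nn: "0 \<le> x * (y - h)\<^sup>2 / ((1 + y) * (1 + h)\<^sup>2)" "0 \<le> 2 * (1 + cells v)\<^sup>2"
    using x y by simp_all
  have "(x * y - h * x)\<^sup>2 \<le> 2 * (1 + cells v)\<^sup>2 * gap v"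
    unfolding sq by (rule mult_mono[OF le' le nn(2,1)])
  then show ?thesis by (simp add: p x_def h_def)
qed

lemma defect_tendsto_0:
  fixes v :: "nat \<Rightarrow> 'a::finite \<Rightarrow> 'b::finite \<Rightarrow> nat"
  assumes "\<And>n. all_positive (v n)" "(\<lambda>n. gap (v n)) \<longlonglongrightarrow> 0"
  shows "(\<lambda>n. succ_prob (v n) i j - potential (v n) * share (v n) i j) \<longlonglongrightarrow> 0"
proof -
  define C where "C = 2 * (1 + cells (v 0))\<^sup>2"
  have "(\<lambda>n. C * gap (v n)) \<longlonglongrightarrow> C * 0" by (intro tendsto_intros assms)
  then have up: "(\<lambda>n. C * gap (v n)) \<longlonglongrightarrow> 0" by simp
  have "(\<lambda>n. (succ_prob (v n) i j - potential (v n) * share (v n) i j)\<^sup>2) \<longlonglongrightarrow> 0"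
    by (rule real_tendsto_sandwich[OF _ _ tendsto_const up])
      (use defect_bound[OF assms(1)] in \<open>auto simp: C_def\<close>)
  from tendsto_real_sqrt[OF this] show ?thesis
    by (simp add: tendsto_rabs_zero_iff)
qed

lemma sum_sum_type:
  fixes g :: "'a::finite + 'b::finite \<Rightarrow> 'c::comm_monoid_add"
  shows "(\<Sum>s\<in>UNIV. g s) = (\<Sum>i\<in>UNIV. g (Inl i)) + (\<Sum>j\<in>UNIV. g (Inr j))"
  by (simp add: UNIV_Plus_UNIV [symmetric] sum.Plus del: UNIV_Plus_UNIV)

lemma T_total_tot: "real (T_total v) = tot v"
proof -
  have "T_at v (Inl i) = (\<Sum>j\<in>UNIV. v i j)" for i by (simp add: T_at_def sum_sum_type)
  then show ?thesis by (simp add: T_total_def tot_def row_sum_def sum.reindex)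
qed

lemma normalized_nth:
  "normalized v $ Inl i $ Inr j = share v i j" "normalized v $ Inr j $ Inl i = share v i j"
  "normalized v $ Inl i $ Inl i' = 0" "normalized v $ Inr j $ Inr j' = 0"
  by (simp_all add: normalized_def share_def T_total_tot)

lemma marginal_normalized:
  "marginal (normalized v) (Inl i) = row_sum v i / tot v"
  "marginal (normalized v) (Inr j) = col_sum v j / tot v"
  by (simp_all add: marginal_def sum_sum_type normalized_nth share_def row_sum_def col_sum_def sum_divide_distrib)

lemma normalized_in_Delta:
  assumes "all_positive v" shows "normalized v \<in> Delta"
proof -
  have "normalized v $ s $ t = normalized v $ t $ s \<and> 0 \<le> normalized v $ s $ t" for s t
    using share_pos[OF assms] by (cases s; cases t) (auto simp: normalized_nth less_imp_le)
  then show ?thesis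
    using sum_share[OF assms] by (auto simp: Delta_def normalized_nth sum.reindex)
qed

lemma closed_Delta: "closed Delta"
  unfolding Delta_def
  by (intro closed_Collect_conj closed_Collect_all closed_Collect_eq closed_Collect_le closed_Collect_imp
      open_Collect_const continuous_intros)

lemma bounded_normalized:
  fixes v :: "nat \<Rightarrow> 'a::finite \<Rightarrow> 'b::finite \<Rightarrow> nat"
  assumes "\<And>n. all_positive (v n)" shows "bounded (range (\<lambda>n. normalized (v n)))"
proof -
  have "norm (normalized (v n)) \<le> (\<Sum>s\<in>(UNIV :: ('a + 'b) set). \<Sum>t\<in>(UNIV :: ('a + 'b) set). 1)" for n
  proof -
    have le1: "\<bar>normalized (v n) $ s $ t\<bar> \<le> 1" for s t
      using share_pos[OF assms, of n] share_le_1[OF assms, of n]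
      by (cases s; cases t) (auto simp: normalized_nth less_imp_le)
    have "(\<Sum>s\<in>UNIV. \<Sum>t\<in>UNIV. \<bar>normalized (v n) $ s $ t\<bar>) \<le> (\<Sum>s\<in>(UNIV :: ('a + 'b) set). \<Sum>t\<in>(UNIV :: ('a + 'b) set). 1)"
      by (intro sum_mono le1)
    moreover have "norm (normalized (v n)) \<le> (\<Sum>s\<in>UNIV. norm (normalized (v n) $ s))"
      by (simp add: norm_vec_def L2_set_le_sum)
    moreover have "(\<Sum>s\<in>UNIV. norm (normalized (v n) $ s)) \<le> (\<Sum>s\<in>UNIV. \<Sum>t\<in>UNIV. \<bar>normalized (v n) $ s $ t\<bar>)"
      by (intro sum_mono norm_le_l1_cart)
    ultimately show ?thesis by linarith
  qed
  then show ?thesis by (auto simp: bounded_iff)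
qed

lemma H_eq_sum:
  assumes "x \<in> Delta"
  shows "H x = (\<Sum>i\<in>UNIV. \<Sum>j\<in>UNIV. (if 0 < x $ Inl i $ Inr j
    then (x $ Inl i $ Inr j)\<^sup>2 / (marginal x (Inl i) * marginal x (Inr j)) else 0))"
proof -
  let ?f = "\<lambda>s t. (x $ s $ t)\<^sup>2 / (marginal x s * marginal x t)"
  have "H x = (\<Sum>p\<in>{p \<in> S1 \<times> S2. 0 < x $ fst p $ snd p}. ?f (fst p) (snd p))"
    unfolding H_def by (rule sum.cong) auto
  also have "\<dots> = (\<Sum>p\<in>S1 \<times> S2. if 0 < x $ fst p $ snd p then ?f (fst p) (snd p) else 0)"
    by (rule sum.inter_filter) simp
  also have "\<dots> = (\<Sum>s\<in>S1. \<Sum>t\<in>S2. if 0 < x $ s $ t then ?f s t else 0)"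
    unfolding sum.cartesian_product by (rule sum.cong) auto
  finally show ?thesis by (simp add: sum.reindex)
qed

text \<open>On the faces \<open>y\<close> need not converge, so the quotient is passed to the limit
  only on edges with positive limit share, where both marginals stay positive. Elsewhere the mean
  field is 0 by definition.\<close>

lemma limit_in_equilibria:
  fixes v :: "nat \<Rightarrow> 'a::finite \<Rightarrow> 'b::finite \<Rightarrow> nat"
  assumes pos: "\<And>n. all_positive (v n)"
    and defect: "\<And>i j. (\<lambda>n. succ_prob (v n) i j - potential (v n) * share (v n) i j) \<longlonglongrightarrow> 0"
    and h: "(\<lambda>n. potential (v n)) \<longlonglongrightarrow> h"
    and x: "(\<lambda>n. normalized (v n)) \<longlonglongrightarrow> x"
  shows "x \<in> equilibria"
proof -
  have Delta: "x \<in> Delta"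
    using closed_sequentially[OF closed_Delta _ x] normalized_in_Delta[OF pos] by blast
  have entry: "(\<lambda>n. normalized (v n) $ s $ t) \<longlonglongrightarrow> x $ s $ t" for s t
    by (intro tendsto_vec_nth x)
  have share: "(\<lambda>n. share (v n) i j) \<longlonglongrightarrow> x $ Inl i $ Inr j" for i j
    using entry[of "Inl i" "Inr j"] by (simp add: normalized_nth)
  have marg: "(\<lambda>n. marginal (normalized (v n)) s) \<longlonglongrightarrow> marginal x s" for s
    unfolding marginal_def by (intro tendsto_sum entry)
  have nonneg: "0 \<le> x $ s $ t" and sym: "x $ s $ t = x $ t $ s" for s t
    using Delta by (auto simp: Delta_def)
  have eq: "(x $ Inl i $ Inr j)\<^sup>2 / (marginal x (Inl i) * marginal x (Inr j)) = h * x $ Inl i $ Inr j"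
    if "0 < x $ Inl i $ Inr j" for i j
  proof (rule LIMSEQ_unique)
    have m: "0 < marginal x s" if "0 < x $ s $ t" for s t
      unfolding marginal_def using that nonneg by (intro sum_pos2[of _ t]) auto
    have "succ_prob (v n) i j = (share (v n) i j)\<^sup>2 / (marginal (normalized (v n)) (Inl i) * marginal (normalized (v n)) (Inr j))" for n
      using all_positive_gt_0(3)[OF pos, of n]
      by (simp add: succ_prob_def share_def marginal_normalized power2_eq_square)
    then show "(\<lambda>n. succ_prob (v n) i j) \<longlonglongrightarrow> (x $ Inl i $ Inr j)\<^sup>2 / (marginal x (Inl i) * marginal x (Inr j))"
      using m[OF that] m[of "Inr j" "Inl i"] that sym[of "Inr j" "Inl i"]
      by (simp only:) (intro tendsto_intros share marg; simp)
    have "(\<lambda>n. (succ_prob (v n) i j - potential (v n) * share (v n) i j) + potential (v n) * share (v n) i j)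
        \<longlonglongrightarrow> 0 + h * x $ Inl i $ Inr j"
      by (intro tendsto_intros defect h share)
    then show "(\<lambda>n. succ_prob (v n) i j) \<longlonglongrightarrow> h * x $ Inl i $ Inr j" by simp
  qed
  \<comment> \<open>The limit \<open>h\<close> is identified with \<open>H x\<close> without
    continuity of \<open>H\<close>: on every edge the summand of \<open>H x\<close> is
    \<open>h\<close> times the share, and the shares sum to 1.\<close>
  have "H x = (\<Sum>i\<in>UNIV. \<Sum>j\<in>UNIV. h * x $ Inl i $ Inr j)"
    unfolding H_eq_sum[OF Delta]
  proof (intro sum.cong refl)
    fix i j
    show "(if 0 < x $ Inl i $ Inr j
        then (x $ Inl i $ Inr j)\<^sup>2 / (marginal x (Inl i) * marginal x (Inr j)) else 0) = h * x $ Inl i $ Inr j"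
      using eq[of i j] nonneg[of "Inl i" "Inr j"] by auto
  qed
  also have "\<dots> = h"
    using Delta by (simp add: Delta_def sum_distrib_left[symmetric] sum.reindex)
  finally have Hx: "H x = h" .
  have zero: "x $ Inl i $ Inl i' = 0" "x $ Inr j $ Inr j' = 0" for i i' j j'
    using Delta by (auto simp: Delta_def)
  have eq': "x $ Inl i $ Inr j / (marginal x (Inl i) * marginal x (Inr j)) = h"
    if "0 < x $ Inl i $ Inr j" for i j
  proof -
    have "x $ Inl i $ Inr j * (x $ Inl i $ Inr j / (marginal x (Inl i) * marginal x (Inr j))) = x $ Inl i $ Inr j * h"
      using eq[OF that] by (simp add: power2_eq_square mult.commute)
    then show ?thesis using that by (simp only: mult_cancel_left) simp
  qed
  have "mean_field x $ s $ t = 0" for s t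
  proof (cases s; cases t)
    fix i j assume "s = Inl i" "t = Inr j"
    then show ?thesis using eq'[of i j] by (simp add: mean_field_def Hx)
  next
    fix i j assume "s = Inr j" "t = Inl i"
    then show ?thesis using eq'[of i j] sym[of "Inr j" "Inl i"]
      by (simp add: mean_field_def Hx mult.commute)
  qed (simp_all add: mean_field_def zero)
  then have "mean_field x = 0" by (simp add: vec_eq_iff)
  then show ?thesis using Delta by (simp add: equilibria_def)
qed

text \<open>Compactness: a subsequence staying away from the equilibria would have a convergent
  subsequence, whose limit is an equilibrium.\<close>

lemma infdist_equilibria_tendsto_0:
  fixes v :: "nat \<Rightarrow> 'a::finite \<Rightarrow> 'b::finite \<Rightarrow> nat"
  assumes pos: "\<And>n. all_positive (v n)"
    and gap: "(\<lambda>n. gap (v n)) \<longlonglongrightarrow> 0"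
    and pot: "convergent (\<lambda>n. potential (v n))"
  shows "(\<lambda>n. infdist (normalized (v n)) equilibria) \<longlonglongrightarrow> 0"
proof (rule ccontr)
  assume "\<not> ?thesis"
  then obtain e where e: "0 < e" "\<not> (\<forall>\<^sub>F n in sequentially. infdist (normalized (v n)) equilibria < e)"
    unfolding tendsto_iff by (auto simp: dist_real_def infdist_nonneg)
  obtain r :: "nat \<Rightarrow> nat" where r: "strict_mono r" "\<And>n. e \<le> infdist (normalized (v (r n))) equilibria"
    using not_eventually_sequentiallyD[OF e(2)] by (auto simp: not_less)
  have "bounded (range (\<lambda>n. normalized (v (r n))))"
    using bounded_normalized[of "v \<circ> r"] pos by simp
  then obtain x s where s: "strict_mono (s :: nat \<Rightarrow> nat)" "((\<lambda>n. normalized (v (r n))) \<circ> s) \<longlonglongrightarrow> x"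
    using bounded_imp_convergent_subsequence by blast
  define u where "u n = v (r (s n))" for n
  have sub: "(\<lambda>n. f (u n)) \<longlonglongrightarrow> l" if "(\<lambda>n. f (v n)) \<longlonglongrightarrow> l" for f :: "_ \<Rightarrow> real" and l
    using LIMSEQ_subseq_LIMSEQ[OF that strict_mono_o[OF r(1) s(1)]] by (simp add: u_def o_def)
  obtain h where h: "(\<lambda>n. potential (v n)) \<longlonglongrightarrow> h" using pot by (auto simp: convergent_def)
  have xu: "(\<lambda>n. normalized (u n)) \<longlonglongrightarrow> x" using s(2) by (simp add: u_def o_def)
  have upos: "all_positive (u n)" for n using pos by (simp add: u_def)
  have eqx: "x \<in> equilibria"
    by (rule limit_in_equilibria[OF upos defect_tendsto_0[OF upos sub[OF gap]] sub[OF h] xu])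
  have "(\<lambda>n. infdist (normalized (u n)) equilibria) \<longlonglongrightarrow> infdist x equilibria"
    by (intro tendsto_infdist xu)
  then have "(\<lambda>n. infdist (normalized (u n)) equilibria) \<longlonglongrightarrow> 0" using eqx by simp
  then have "e \<le> 0"
    by (rule LIMSEQ_le_const) (use r(2) in \<open>auto simp: u_def\<close>)
  then show False using e(1) by simp
qed

theorem theorem2p2:
  fixes M :: "'w measure" and F :: "nat \<Rightarrow> 'w measure"
    and V :: "nat \<Rightarrow> 'w \<Rightarrow> 'a::finite \<Rightarrow> 'b::finite \<Rightarrow> nat"
  assumes "signaling_process M F V"
  shows "AE \<omega> in M. (\<lambda>n. infdist (normalized (V n \<omega>)) equilibria) \<longlonglongrightarrow> 0"
proof -
  interpret signaling_process M F V by fact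
  show ?thesis
    using AE_steps_ok AE_convergent_compensated[OF tame_adjusted_potential]
      AE_convergent_compensated[OF tame_lyapunov]
  proof eventually_elim
    case (elim \<omega>)
    show ?case
      by (rule infdist_equilibria_tendsto_0[OF steps_ok_bounds(1)[OF elim(1)] gap_tendsto_0[OF elim]])
  qed
qed

end
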